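(* Let $G$ be an arbitrary finite simple graph with no connected components of order less than $3$. Suppose that $G$ does not contain any ugly component $C_1$ with $\chi(C_1)=\chi(G)$, and that, in the case when $\chi(G)=2^q$ for some integer $q\geq 2$, $G$ has no component $C_2\cong K_{\chi(G)-2}$. Then $\chi^\Sigma_g(G)=\chi(G)$. Otherwise (i.e. if one of these two conditions fails), $\chi^\Sigma_g(G)=\chi(G)+1$.
   Context: All groups are Abelian, written additively with neutral element $0$. For a graph $G$ and an Abelian group $\mathcal{G}$, an edge labelling $f:E(G)\to\mathcal{G}$ defines the weighted degree $w(v)=\sum_{e\ni v} f(e)$ of each vertex $v$. The labelling $f$ is called vertex-$\mathcal{G}$-colouring if $w(u)\neq w(v)$ for every edge $uv$ of $G$. The group sum chromatic number $\chi^\Sigma_g(G)$ is the smallest integer $s$ such that for every Abelian group $\mathcal{G}$ of order $s$ there exists a vertex-$\mathcal{G}$-colouring labelling $f:E(G)\to\mathcal{G}$. $\chi(G)$ denotes the ordinary chromatic number. A colour class is odd (even) if it has odd (even) cardinality. A connected graph $G$ of order at least $3$ is called ugly if either (i) $\chi(G)=4k+2$ for some integer $k\geq 0$ and in every proper $\chi(G)$-colouring of $G$ all colour classes are odd, or (ii) $\chi(G)=2^q$ for some integer $q\geq 2$ and in every proper $\chi(G)$-colouring of $G$ either exactly $2$ or exactly $2^q-2$ colour classes are odd. *)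

theory Defs
  imports "HOL-Library.FuncSet" "HOL-Algebra.FiniteProduct" "HOL-Algebra.Coset"
    "HOL-Algebra.Weak_Morphisms"
begin

record 'a sgraph =
  verts :: "'a set"
  edges :: "'a set set"

definition finite_simple_graph :: "'a sgraph \<Rightarrow> bool" where
  "finite_simple_graph G \<longleftrightarrow>
     finite (verts G) \<and> (\<forall>e\<in>edges G. e \<subseteq> verts G \<and> card e = 2)"

definition adj :: "'a sgraph \<Rightarrow> ('a \<times> 'a) set" where
  "adj G = {(u, v). {u, v} \<in> edges G}"

definition connected_graph :: "'a sgraph \<Rightarrow> bool" where
  "connected_graph G \<longleftrightarrow>
     verts G \<noteq> {} \<and> (\<forall>u\<in>verts G. \<forall>v\<in>verts G. (u, v) \<in> (adj G)\<^sup>*)"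

definition induced_subgraph :: "'a sgraph \<Rightarrow> 'a set \<Rightarrow> 'a sgraph" where
  "induced_subgraph G W = \<lparr>verts = W, edges = {e \<in> edges G. e \<subseteq> W}\<rparr>"

definition graph_components :: "'a sgraph \<Rightarrow> 'a sgraph set" where
  "graph_components G =
     {induced_subgraph G {u \<in> verts G. (v, u) \<in> (adj G)\<^sup>*} | v. v \<in> verts G}"

definition complete_graph :: "nat \<Rightarrow> nat sgraph" where
  "complete_graph n = \<lparr>verts = {..<n}, edges = {e. e \<subseteq> {..<n} \<and> card e = 2}\<rparr>"

definition graph_isomorphic :: "'a sgraph \<Rightarrow> 'b sgraph \<Rightarrow> bool" where
  "graph_isomorphic G H \<longleftrightarrow>
     (\<exists>\<phi>. bij_betw \<phi> (verts G) (verts H) \<and> edges H = (\<lambda>e. \<phi> ` e) ` edges G)"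

definition proper_colouring :: "'a sgraph \<Rightarrow> nat \<Rightarrow> ('a \<Rightarrow> nat) \<Rightarrow> bool" where
  "proper_colouring G k c \<longleftrightarrow>
     c \<in> verts G \<rightarrow> {..<k} \<and> (\<forall>u v. {u, v} \<in> edges G \<longrightarrow> c u \<noteq> c v)"

definition chromatic_number :: "'a sgraph \<Rightarrow> nat" where
  "chromatic_number G = (LEAST k. \<exists>c. proper_colouring G k c)"

definition colour_class :: "'a sgraph \<Rightarrow> ('a \<Rightarrow> nat) \<Rightarrow> nat \<Rightarrow> 'a set" where
  "colour_class G c i = {v \<in> verts G. c v = i}"

definition odd_classes :: "'a sgraph \<Rightarrow> nat \<Rightarrow> ('a \<Rightarrow> nat) \<Rightarrow> nat set" where
  "odd_classes G k c = {i. i < k \<and> odd (card (colour_class G c i))}"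

definition ugly :: "'a sgraph \<Rightarrow> bool" where
  "ugly G \<longleftrightarrow> connected_graph G \<and> card (verts G) \<ge> 3 \<and>
     ((\<exists>k. chromatic_number G = 4 * k + 2) \<and>
        (\<forall>c. proper_colouring G (chromatic_number G) c \<longrightarrow>
           (\<forall>i<chromatic_number G. odd (card (colour_class G c i))))
      \<or> (\<exists>q\<ge>2. chromatic_number G = 2 ^ q \<and>
        (\<forall>c. proper_colouring G (chromatic_number G) c \<longrightarrow>
           card (odd_classes G (chromatic_number G) c) = 2 \<or>
           card (odd_classes G (chromatic_number G) c) = 2 ^ q - 2)))"

(* HOL-Algebra writes groups multiplicatively, so the sum of labels appears as finprod. *)
definition weighted_degree :: "('b, 'm) monoid_scheme \<Rightarrow> 'a sgraph \<Rightarrow> ('a set \<Rightarrow> 'b) \<Rightarrow> 'a \<Rightarrow> 'b" where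
  "weighted_degree \<G> G f v = finprod \<G> f {e \<in> edges G. v \<in> e}"

definition vertex_group_colouring ::
    "('b, 'm) monoid_scheme \<Rightarrow> 'a sgraph \<Rightarrow> ('a set \<Rightarrow> 'b) \<Rightarrow> bool" where
  "vertex_group_colouring \<G> G f \<longleftrightarrow>
     f \<in> edges G \<rightarrow> carrier \<G> \<and>
     (\<forall>u v. {u, v} \<in> edges G \<longrightarrow> weighted_degree \<G> G f u \<noteq> weighted_degree \<G> G f v)"

(* A definition cannot quantify over the type of group elements.  Every finite group has an
   isomorphic copy whose carrier is a set of natural numbers, so nothing is lost by letting
   the groups range over this type; see the lemma below. *)
definition group_sum_colourable :: "'a sgraph \<Rightarrow> nat \<Rightarrow> bool" where
  "group_sum_colourable G s \<longleftrightarrow>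
     (\<forall>\<G> :: nat monoid. comm_group \<G> \<and> order \<G> = s \<longrightarrow> (\<exists>f. vertex_group_colouring \<G> G f))"

lemma group_sum_colourable_any_type:
  fixes \<G> :: "('b, 'm) monoid_scheme"
  assumes "comm_group \<G>" and "order \<G> = s" and "0 < s" and "group_sum_colourable G s"
  shows "\<exists>f. vertex_group_colouring \<G> G f"
proof -
  interpret H: comm_group \<G> by fact
  have fin: "finite (carrier \<G>)"
    using assms(2,3) card_ge_0_finite unfolding order_def by blast
  obtain h :: "'b \<Rightarrow> nat" where inj: "inj_on h (carrier \<G>)"
    using finite_imp_inj_to_nat_seg[OF fin] by blast
  define K :: "nat monoid" where "K = image_group h \<G>"
  have cK: "carrier K = h ` carrier \<G>" and oK: "\<one>\<^bsub>K\<^esub> = h \<one>\<^bsub>\<G>\<^esub>"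
    by (simp_all add: K_def image_group_def)
  have mK: "h x \<otimes>\<^bsub>K\<^esub> h y = h (x \<otimes>\<^bsub>\<G>\<^esub> y)" if "x \<in> carrier \<G>" "y \<in> carrier \<G>" for x y
    using that inj by (simp add: K_def image_group_def)
  have K: "comm_group K"
  proof (rule comm_groupI)
    fix x assume "x \<in> carrier K"
    then obtain a where "a \<in> carrier \<G>" "x = h a" by (auto simp: cK)
    then show "\<exists>y\<in>carrier K. y \<otimes>\<^bsub>K\<^esub> x = \<one>\<^bsub>K\<^esub>"
      by (intro bexI[of _ "h (inv\<^bsub>\<G>\<^esub> a)"]) (auto simp: cK mK oK)
  qed (auto simp: cK mK oK H.m_ac)
  then interpret K: comm_group K .
  have "order K = s"
    using assms(2) inj by (simp add: order_def cK card_image)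
  then obtain f where f: "vertex_group_colouring K G f"
    using assms(4) K unfolding group_sum_colourable_def by blast
  define g where "g e = inv_into (carrier \<G>) h (f e)" for e
  have fK: "f e \<in> h ` carrier \<G>" if "e \<in> edges G" for e
    using f that by (auto simp: vertex_group_colouring_def cK)
  have gc: "g e \<in> carrier \<G>" and hg: "h (g e) = f e" if "e \<in> edges G" for e
    using fK[OF that] by (auto simp: g_def inv_into_into f_inv_into_f)
  have fp: "finprod \<G> g A \<in> carrier \<G> \<and> finprod K f A = h (finprod \<G> g A)"
    if "A \<subseteq> edges G" for A
    using that
  proof (induction A rule: infinite_finite_induct)
    case (insert e A)
    moreover have "g \<in> A \<rightarrow> carrier \<G>" "f \<in> A \<rightarrow> carrier K" "g e \<in> carrier \<G>" "f e \<in> carrier K"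
      using insert.prems gc fK by (auto simp: cK)
    moreover have "h (g e) = f e" using insert.prems hg by auto
    ultimately show ?case using mK by (metis H.finprod_insert K.finprod_insert H.m_closed insert_subset)
  qed (simp_all add: oK)
  have "weighted_degree K G f v = h (weighted_degree \<G> G g v)" for v
    using fp[of "{e \<in> edges G. v \<in> e}"] by (simp add: weighted_degree_def)
  with f gc have "vertex_group_colouring \<G> G g"
    unfolding vertex_group_colouring_def Pi_iff by metis
  then show ?thesis by blast
qed

(* No group has order 0, so s must be required to be positive for the minimum to be meaningful. *)
definition group_sum_chromatic_number :: "'a sgraph \<Rightarrow> nat" where
  "group_sum_chromatic_number G = (LEAST s. 0 < s \<and> group_sum_colourable G s)"

end

theory Submission
  imports Defs "HOL-Algebra.Sylow" "HOL-Algebra.Elementary_Groups"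
begin

text \<open>
  On a connected graph, weights can be moved along walks by alternately adding and subtracting a
  group element on the edges.  Hence, if the graph has an odd closed walk, a weight function is
  realized by an edge labelling iff its total is twice a group element; on a bipartite graph one
  needs equal totals on the two sides, which is easy to arrange in a group of order at least three.
  Up to such doubles the total of a proper colouring by group elements is the sum of the colours
  whose classes are odd.  A set of \<open>t\<close> elements whose sum is a double exists in every abelian group
  of order \<open>s\<close>, except when \<open>s\<close> is 2 modulo 4 and \<open>t = s\<close>, or when the group is an elementary
  2-group of order at least four and \<open>t\<close> is \<open>2\<close> or \<open>s - 2\<close>.  These exceptions are the two kinds of
  ugly component, and, where spare colours are available to change the parities, only complete
  graphs on \<open>s - 2\<close> vertices remain stuck.  The cyclic and the elementary abelian group
  give the obstructions; a group of odd order never obstructs.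
\<close>

section \<open>Products of subsets of a finite abelian group\<close>

text \<open>Only the number \<open>t\<close> of odd classes matters because the bijection between
  colours and group elements is free: the odd classes can be sent onto any prescribed
  \<open>t\<close>-subset. Doubles appear because every edge label is counted at both ends of its
  edge. If the order is 2 modulo 4, there is a single element of order two. It is the sum of the
  whole group, and it is no double, since the doubles form a subgroup of odd order. In an elementary
  2-group the only double is 0; two distinct elements never cancel, and since the whole group sums
  to 0 from order four on, neither does the complement of a pair. In other groups, elements of order
  above two come in inverse pairs of sum 0, and exchanging such pairs for elements of order at most
  two leads around the bad sizes. Both obstructions need an even order. So whenever the chromatic
  number is not attained it is even, and its successor is odd, which is why adding 1 always
  suffices.\<close>

lemma involution_transversal:
  assumes "finite A" and "\<And>x. x \<in> A \<Longrightarrow> \<phi> x \<in> A \<and> \<phi> (\<phi> x) = x \<and> \<phi> x \<noteq> x"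
  shows "\<exists>R\<subseteq>A. R \<inter> \<phi> ` R = {} \<and> R \<union> \<phi> ` R = A"
  using assms
proof (induction A rule: finite_psubset_induct)
  case (psubset A)
  show ?case
  proof (cases "A = {}")
    case False
    then obtain x where x: "x \<in> A" by blast
    note inv = psubset.prems
    define B where "B = A - {x, \<phi> x}"
    have sub: "B \<subset> A" using x by (auto simp: B_def)
    have "\<phi> y \<in> B \<and> \<phi> (\<phi> y) = y \<and> \<phi> y \<noteq> y" if "y \<in> B" for y
      using that inv[of y] inv[of x] x by (auto simp: B_def)
    then obtain R where R: "R \<subseteq> B" "R \<inter> \<phi> ` R = {}" "R \<union> \<phi> ` R = B"
      using psubset.IH[OF sub] by blast
    have "\<phi> y \<noteq> x" if "y \<in> R" for y
      using that R inv[of y] inv[of x] x by (auto simp: B_def)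
    then have "insert x R \<inter> \<phi> ` insert x R = {}"
      using R inv[of x] x by (auto simp: B_def)
    moreover have "insert x R \<union> \<phi> ` insert x R = A"
      using R inv[of x] x by (auto simp: B_def)
    ultimately show ?thesis by (metis Un_upper1)
  qed auto
qed

lemma involution_inj_on:
  assumes "\<And>x. x \<in> A \<Longrightarrow> \<phi> (\<phi> x) = x"
  shows "inj_on \<phi> A"
  by (metis assms inj_onI)

lemma card_involution_pairs:
  assumes "finite R" and "inj_on \<phi> R" and "R \<inter> \<phi> ` R = {}"
  shows "card (R \<union> \<phi> ` R) = 2 * card R"
  using assms by (simp add: card_Un_disjoint card_image)

lemma even_card_involution:
  assumes "finite A" and "\<And>x. x \<in> A \<Longrightarrow> \<phi> x \<in> A \<and> \<phi> (\<phi> x) = x \<and> \<phi> x \<noteq> x"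
  shows "even (card A)"
proof -
  obtain R where R: "R \<subseteq> A" "R \<inter> \<phi> ` R = {}" "R \<union> \<phi> ` R = A"
    using involution_transversal[OF assms] by blast
  moreover have "inj_on \<phi> R"
    using assms(2) R(1) by (intro involution_inj_on) blast
  moreover have "finite R" using R(1) assms(1) finite_subset by blast
  ultimately show ?thesis using card_involution_pairs[of R \<phi>] by simp
qed

section \<open>Elements of order at most two, and subsets whose product is a square\<close>

context comm_group
begin

text \<open>The neutral element is included, so this is the subgroup of elements of order at most
  two; cardinality 2 means exactly one element of order two.\<close>

definition involutions :: "'a set" where
  "involutions = {x \<in> carrier G. x \<otimes> x = \<one>}"

abbreviation set_prod :: "'a set \<Rightarrow> 'a" where
  "set_prod T \<equiv> finprod G (\<lambda>x. x) T"

lemma involutions_carrier: "involutions \<subseteq> carrier G"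
  by (auto simp: involutions_def)

lemma one_involution: "\<one> \<in> involutions"
  by (simp add: involutions_def)

lemma involution_mult:
  assumes "x \<in> involutions" and "y \<in> involutions"
  shows "x \<otimes> y \<in> involutions"
proof -
  have "(x \<otimes> y) \<otimes> (x \<otimes> y) = (x \<otimes> x) \<otimes> (y \<otimes> y)"
    using assms by (simp add: involutions_def m_ac)
  then show ?thesis using assms by (simp add: involutions_def)
qed

lemma involution_translate:
  assumes "p \<in> involutions" and "x \<in> carrier G"
  shows "x \<otimes> p \<otimes> p = x"
  using assms by (simp add: involutions_def m_assoc)

lemma involution_translate_neq:
  assumes "p \<in> carrier G" "p \<noteq> \<one>" and "x \<in> carrier G"
  shows "x \<otimes> p \<noteq> x"
  using assms by simp

lemma set_prod_closed: "T \<subseteq> carrier G \<Longrightarrow> set_prod T \<in> carrier G"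
  by (rule finprod_closed) auto

lemma set_prod_involutions:
  assumes "finite T" and "T \<subseteq> involutions"
  shows "set_prod T \<in> involutions"
  using assms
proof induction
  case empty
  show ?case by (simp add: one_involution)
next
  case (insert x T)
  then have "set_prod (insert x T) = x \<otimes> set_prod T"
    using involutions_carrier by (subst finprod_insert) auto
  then show ?case using insert involution_mult by simp
qed

lemma set_prod_insert:
  assumes "finite T" "x \<notin> T" "insert x T \<subseteq> carrier G"
  shows "set_prod (insert x T) = x \<otimes> set_prod T"
  using assms by (subst finprod_insert) auto

lemma set_prod_Un_disjoint:
  assumes "finite A" "finite B" "A \<inter> B = {}" "A \<subseteq> carrier G" "B \<subseteq> carrier G"
  shows "set_prod (A \<union> B) = set_prod A \<otimes> set_prod B"
  using assms by (intro finprod_Un_disjoint) auto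

lemma set_prod_pairs:
  assumes "finite R" "inj_on \<phi> R" "R \<inter> \<phi> ` R = {}" "R \<union> \<phi> ` R \<subseteq> carrier G"
  shows "set_prod (R \<union> \<phi> ` R) = finprod G (\<lambda>x. x \<otimes> \<phi> x) R"
proof -
  have "set_prod (R \<union> \<phi> ` R) = set_prod R \<otimes> set_prod (\<phi> ` R)"
    using assms by (intro set_prod_Un_disjoint) auto
  also have "set_prod (\<phi> ` R) = finprod G \<phi> R"
    using assms by (subst finprod_reindex) auto
  also have "set_prod R \<otimes> finprod G \<phi> R = finprod G (\<lambda>x. x \<otimes> \<phi> x) R"
    using assms by (subst finprod_multf) auto
  finally show ?thesis .
qed

text \<open>Translation by \<open>p\<close> pairs \<open>x\<close> with
  \<open>x \<otimes> p\<close>. As \<open>x \<otimes> x\<close> is neutral, each pair has product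
  \<open>p\<close>, and the exponent counts the pairs.\<close>

lemma set_prod_involutions_eq_pow:
  assumes fin: "finite (carrier G)" and p: "p \<in> involutions" "p \<noteq> \<one>"
  shows "even (card involutions) \<and> set_prod involutions = p [^] (card involutions div 2)"
proof -
  let ?\<phi> = "\<lambda>x. x \<otimes> p"
  have pc: "p \<in> carrier G" using p involutions_carrier by blast
  have fE: "finite involutions" using fin finite_subset involutions_carrier by blast
  have inv: "?\<phi> x \<in> involutions \<and> ?\<phi> (?\<phi> x) = x \<and> ?\<phi> x \<noteq> x" if "x \<in> involutions" for x
    using that p involution_mult involution_translate involution_translate_neq pc
      involutions_carrier by blast
  obtain R where R: "R \<subseteq> involutions" "R \<inter> ?\<phi> ` R = {}" "R \<union> ?\<phi> ` R = involutions"
    using involution_transversal[of involutions ?\<phi>, OF fE inv] by blast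
  have inj: "inj_on ?\<phi> R" using R(1) inv by (intro involution_inj_on) blast
  have fR: "finite R" using R(1) fE finite_subset by blast
  have card: "card involutions = 2 * card R"
    using card_involution_pairs[OF fR inj R(2)] R(3) by simp
  have "set_prod involutions = finprod G (\<lambda>x. x \<otimes> ?\<phi> x) R"
    using set_prod_pairs[OF fR inj R(2)] R(3) involutions_carrier by simp
  also have "\<dots> = finprod G (\<lambda>x. p) R"
  proof (rule finprod_cong')
    fix x assume "x \<in> R"
    then have x: "x \<in> carrier G" "x \<otimes> x = \<one>" using R(1) by (auto simp: involutions_def)
    then show "x \<otimes> (x \<otimes> p) = p" using pc by (simp add: m_assoc[symmetric])
  qed (use pc in auto)
  also have "\<dots> = p [^] card R" by (rule finprod_const[OF pc])
  finally show ?thesis using card by simp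
qed

lemma involution_pow:
  assumes "p \<in> involutions"
  shows "p [^] n = (if even (n::nat) then \<one> else p)"
proof -
  have "p \<otimes> p = \<one>" "p \<in> carrier G" using assms by (auto simp: involutions_def)
  then show ?thesis by (induction n) auto
qed

text \<open>Two different nonneutral choices of \<open>p\<close> in the pairing yield the same
  product. An odd number of pairs would make these choices equal, so the number of pairs is
  even.\<close>

lemma set_prod_all_involutions:
  assumes fin: "finite (carrier G)" and card: "card involutions \<ge> 3"
  shows "4 dvd card involutions" and "set_prod involutions = \<one>"
proof -
  have fE: "finite involutions" using fin finite_subset involutions_carrier by blast
  have "\<not> involutions \<subseteq> {\<one>}" using card card_mono[of "{\<one>}" involutions] by auto
  then obtain p where p: "p \<in> involutions" "p \<noteq> \<one>" by blast
  have "card {\<one>, p} \<le> 2" by (simp add: card_insert_if)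
  then have "\<not> involutions \<subseteq> {\<one>, p}" using card card_mono[of "{\<one>, p}" involutions] by auto
  then obtain q where q: "q \<in> involutions" "q \<noteq> \<one>" "q \<noteq> p" by blast
  note P = set_prod_involutions_eq_pow[OF fin p] and Q = set_prod_involutions_eq_pow[OF fin q(1,2)]
  have ev: "even (card involutions div 2)"
    using P Q p q involution_pow[OF p(1)] involution_pow[OF q(1)] by metis
  have "even (card involutions)" using P by blast
  then show "4 dvd card involutions" using ev by presburger
  show "set_prod involutions = \<one>" using P ev involution_pow[OF p(1)] by simp
qed

lemma card_involutions_pos:
  assumes "finite (carrier G)"
  shows "card involutions \<ge> 1"
  by (metis assms card_0_eq empty_iff finite_subset involutions_carrier less_one linorder_not_le
      one_involution)

text \<open>Start with \<open>t - 2\<close> elements of product \<open>p \<noteq> \<one>\<close>.  The pairs \<open>{x, x \<otimes> p}\<close> have product \<open>p\<close>,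
  and by counting one of them is disjoint from the chosen elements.\<close>
lemma involution_subset_small:
  assumes fin: "finite (carrier G)" and t: "3 \<le> t" "2 * t < card involutions + 4"
  shows "\<exists>T\<subseteq>involutions. card T = t \<and> set_prod T = \<one>"
proof -
  have fE: "finite involutions" using fin finite_subset involutions_carrier by blast
  have "\<exists>S\<subseteq>involutions. card S = t - 2 \<and> set_prod S \<noteq> \<one>"
  proof -
    have "t - 2 \<le> card involutions" using t by linarith
    then obtain S where S: "S \<subseteq> involutions" "card S = t - 2" "finite S"
      by (rule obtain_subset_with_card_n)
    show ?thesis
    proof (cases "set_prod S = \<one>")
      case True
      \<comment> \<open>Exchanging one member \<open>a\<close> for an outsider \<open>b\<close>
        changes a trivial product. The bound \<open>3 \<le> t\<close> makes \<open>S\<close>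
        nonempty.\<close>
      obtain a where a: "a \<in> S" using S t by fastforce
      have "card S < card involutions" using S t by linarith
      then have "\<not> involutions \<subseteq> S" using card_mono[OF S(3), of involutions] by linarith
      then obtain b where b: "b \<in> involutions" "b \<notin> S" by blast
      have c: "S \<subseteq> carrier G" "b \<in> carrier G" using S b involutions_carrier by auto
      have "set_prod (insert a (S - {a})) = a \<otimes> set_prod (S - {a})"
        using S a c by (intro set_prod_insert) auto
      then have 1: "a \<otimes> set_prod (S - {a}) = \<one>" using True a by (simp add: insert_absorb)
      have 2: "set_prod (insert b (S - {a})) = b \<otimes> set_prod (S - {a})"
        using S b c by (intro set_prod_insert) auto
      have "set_prod (S - {a}) \<in> carrier G" using c by (intro set_prod_closed) auto
      then have "set_prod (insert b (S - {a})) \<noteq> \<one>"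
        using 1 2 a b c by (metis right_cancel subsetD)
      moreover have "card (insert b (S - {a})) = t - 2"
        using S a b by (metis Diff_iff card_Suc_Diff1 card_insert_disjoint finite_Diff)
      moreover have "insert b (S - {a}) \<subseteq> involutions" using S b by auto
      ultimately show ?thesis by blast
    qed (use S in blast)
  qed
  then obtain S where S: "S \<subseteq> involutions" "card S = t - 2" "set_prod S \<noteq> \<one>" by blast
  define p where "p = set_prod S"
  let ?\<phi> = "\<lambda>x. x \<otimes> p"
  have fS: "finite S" using S fE finite_subset by blast
  have p: "p \<in> involutions" "p \<noteq> \<one>" "p \<in> carrier G"
    using set_prod_involutions[OF fS S(1)] S(3) involutions_carrier by (auto simp: p_def)
  have "card (S \<union> ?\<phi> ` S) \<le> (t - 2) + (t - 2)"
    using card_Un_le[of S "?\<phi> ` S"] card_image_le[OF fS, of ?\<phi>] S(2) by linarith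
  then have "card (S \<union> ?\<phi> ` S) < card involutions" using t by linarith
  then have "\<not> involutions \<subseteq> S \<union> ?\<phi> ` S"
    using card_mono[of "S \<union> ?\<phi> ` S" involutions] fS by auto
  then obtain x where x: "x \<in> involutions" "x \<notin> S" "x \<notin> ?\<phi> ` S" by blast
  have xc: "x \<in> carrier G" using x involutions_carrier by blast
  define T where "T = insert x (insert (x \<otimes> p) S)"
  have xp: "x \<otimes> p \<notin> S" using x(3) involution_translate[OF p(1) xc] by (metis imageI)
  have ne: "x \<otimes> p \<noteq> x" using involution_translate_neq p xc by blast
  have sub: "T \<subseteq> involutions" using x S p involution_mult by (auto simp: T_def)
  have "card T = t" using x xp ne fS S(2) t by (auto simp: T_def card_insert_if)
  moreover have "set_prod T = x \<otimes> (x \<otimes> p \<otimes> p)"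
    using sub involutions_carrier x xp ne fS unfolding T_def
    by (subst set_prod_insert, force, force, force, subst set_prod_insert) (auto simp: p_def)
  then have "set_prod T = \<one>" using involution_translate[OF p(1) xc] x by (simp add: involutions_def)
  ultimately show ?thesis using sub by blast
qed

text \<open>Sizes beyond the counting bound are reached by complements, because the whole subgroup
  has product one once it has three elements. Complementation exchanges the two excluded sizes
  \<open>2\<close> and \<open>card involutions - 2\<close>.\<close>

lemma involution_subset:
  assumes fin: "finite (carrier G)" and t: "t \<le> card involutions" "t \<noteq> 2"
    and t2: "card involutions \<ge> 3 \<Longrightarrow> t + 2 \<noteq> card involutions"
  shows "\<exists>T\<subseteq>involutions. card T = t \<and> set_prod T = \<one>"
proof -
  have fE: "finite involutions" using fin finite_subset involutions_carrier by blast
  have small: "\<exists>T\<subseteq>involutions. card T = t \<and> set_prod T = \<one>"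
    if "t \<noteq> 2" "2 * t < card involutions + 4" for t
  proof -
    consider "t = 0" | "t = 1" | "t \<ge> 3" using \<open>t \<noteq> 2\<close> by linarith
    then show ?thesis
    proof cases
      case 1
      then show ?thesis by (intro exI[of _ "{}"]) auto
    next
      case 2
      then show ?thesis using one_involution by (intro exI[of _ "{\<one>}"]) (auto simp: finprod_insert)
    qed (use involution_subset_small[OF fin] that in blast)
  qed
  show ?thesis
  proof (cases "2 * t < card involutions + 4")
    case False
    then have c3: "card involutions \<ge> 3" using t by linarith
    have "card involutions - t \<noteq> 2" "2 * (card involutions - t) < card involutions + 4"
      using False t t2[OF c3] by linarith+
    then obtain T where T: "T \<subseteq> involutions" "card T = card involutions - t" "set_prod T = \<one>"
      using small by blast
    have fT: "finite T" using T fE finite_subset by blast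
    have "set_prod (T \<union> (involutions - T)) = set_prod T \<otimes> set_prod (involutions - T)"
      using T fE fT involutions_carrier by (intro set_prod_Un_disjoint) auto
    moreover have "T \<union> (involutions - T) = involutions" using T by auto
    moreover have "set_prod (involutions - T) \<in> carrier G"
      using involutions_carrier by (intro set_prod_closed) auto
    ultimately have "set_prod (involutions - T) = \<one>"
      using T(3) set_prod_all_involutions(2)[OF fin c3] by simp
    moreover have "card (involutions - T) = t" using T fT t by (simp add: card_Diff_subset)
    ultimately show ?thesis by blast
  qed (use small t in blast)
qed

text \<open>Inversion has no fixed point outside \<open>involutions\<close>, so any number of pairs
  \<open>{x, inv x}\<close>, each of product one, can be collected there.\<close>

lemma inverse_pairs_subset:
  assumes fin: "finite (carrier G)" and p: "2 * p \<le> card (carrier G - involutions)"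
  shows "\<exists>T\<subseteq>carrier G - involutions. card T = 2 * p \<and> set_prod T = \<one>"
    and "even (card (carrier G - involutions))"
proof -
  let ?A = "carrier G - involutions"
  let ?i = "\<lambda>x. inv x"
  have sq: "x \<otimes> x = \<one> \<longleftrightarrow> inv x = x" if "x \<in> carrier G" for x
    using that by (metis inv_equality r_inv)
  have inv: "?i x \<in> ?A \<and> ?i (?i x) = x \<and> ?i x \<noteq> x" if "x \<in> ?A" for x
    using that sq[of x] sq[of "inv x"] by (auto simp: involutions_def)
  have fA: "finite ?A" using fin by simp
  show "even (card ?A)" using even_card_involution[of ?A ?i, OF fA inv] by simp
  obtain R where R: "R \<subseteq> ?A" "R \<inter> ?i ` R = {}" "R \<union> ?i ` R = ?A"
    using involution_transversal[of ?A ?i, OF fA inv] by blast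
  have inj: "inj_on ?i R" using R(1) inv by (intro involution_inj_on) blast
  have fR: "finite R" using R(1) fA finite_subset by blast
  have "card ?A = 2 * card R" using card_involution_pairs[OF fR inj R(2)] R(3) by simp
  then have "p \<le> card R" using p by linarith
  then obtain S where S: "S \<subseteq> R" "card S = p" "finite S" by (rule obtain_subset_with_card_n)
  have iS: "?i ` S \<subseteq> ?i ` R" using S(1) by (rule image_mono)
  have S': "inj_on ?i S" "S \<inter> ?i ` S = {}" "S \<union> ?i ` S \<subseteq> ?A"
    using inj_on_subset[OF inj S(1)] Int_mono[OF S(1) iS] R(2) Un_mono[OF S(1) iS] R(3)
    by simp_all
  have "set_prod (S \<union> ?i ` S) = finprod G (\<lambda>x. x \<otimes> inv x) S"
    using set_prod_pairs[OF S(3) S'(1,2)] S'(3) by auto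
  also have "\<dots> = \<one>"
    using S'(3) by (intro finprod_one_eqI r_inv) auto
  finally have "set_prod (S \<union> ?i ` S) = \<one>" .
  moreover have "card (S \<union> ?i ` S) = 2 * p" using card_involution_pairs[OF S(3) S'(1,2)] S(2) by simp
  ultimately show "\<exists>T\<subseteq>?A. card T = 2 * p \<and> set_prod T = \<one>" using S'(3) by blast
qed

text \<open>The set is assembled from \<open>t'\<close> elements of \<open>involutions\<close> and
  \<open>p\<close> inverse pairs. The sizes that are bad for \<open>involutions\<close> are avoided
  by moving one pair from one supply to the other, which fails only if there are no inverse
  pairs.\<close>

lemma subset_prod_one:
  assumes fin: "finite (carrier G)" and t: "t \<le> order G"
    and e2: "card involutions = 2 \<Longrightarrow> t \<noteq> order G"
    and el: "card involutions = order G \<Longrightarrow> 4 \<le> order G \<Longrightarrow> t \<noteq> 2 \<and> t + 2 \<noteq> order G"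
  shows "\<exists>T\<subseteq>carrier G. card T = t \<and> set_prod T = \<one>"
proof -
  let ?e = "card involutions"
  have fE: "finite involutions" using fin finite_subset involutions_carrier by blast
  have card: "card (carrier G - involutions) = order G - ?e"
    by (simp add: order_def card_Diff_subset[OF fE involutions_carrier])
  have le: "?e \<le> order G" unfolding order_def by (rule card_mono[OF fin involutions_carrier])
  have ev: "even (order G - ?e)" using inverse_pairs_subset(2)[OF fin, of 0] card by simp
  have e: "?e = 1 \<or> ?e = 2 \<or> (\<exists>m\<ge>1. ?e = 4 * m)"
  proof (cases "?e \<ge> 3")
    case True
    then show ?thesis using set_prod_all_involutions(1)[OF fin True] by fastforce
  next
    case False
    then show ?thesis using card_involutions_pos[OF fin] by linarith
  qed
  have "\<exists>t' p. t = t' + 2 * p \<and> 2 * p \<le> order G - ?e \<and> t' \<le> ?e \<and> t' \<noteq> 2 \<and> (?e \<ge> 3 \<longrightarrow> t' + 2 \<noteq> ?e)"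
  \<comment> \<open>Either inverse pairs and at most one further element suffice, or all
    \<open>m\<close> pairs are used and \<open>u\<close> elements of \<open>involutions\<close>
    remain to be found.\<close>
  proof (cases "t \<le> order G - ?e + 1")
    case True
    have m1: "t mod 2 \<le> 1" by simp
    have "t = t mod 2 + 2 * (t div 2)" "t mod 2 \<noteq> 2" by presburger+
    moreover have "2 * (t div 2) \<le> order G - ?e" using True ev by presburger
    moreover have "t mod 2 \<le> ?e" using e m1 by auto
    moreover have "?e \<ge> 3 \<longrightarrow> t mod 2 + 2 \<noteq> ?e" using e m1 by presburger
    ultimately show ?thesis by blast
  next
    case False
    define m where "m = (order G - ?e) div 2"
    have m: "order G = ?e + 2 * m" using ev le by (simp add: m_def)
    define u where "u = t - 2 * m"
    have u: "t = u + 2 * m" "2 \<le> u" "u \<le> ?e" using False m t by (auto simp: u_def)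
    consider "u \<noteq> 2" "?e \<ge> 3 \<longrightarrow> u + 2 \<noteq> ?e" | "u = 2" | "u + 2 = ?e" "?e \<ge> 3" "u \<noteq> 2" by blast
    then show ?thesis
    proof cases
      case 1
      then show ?thesis using u m by (intro exI[of _ u] exI[of _ m]) auto
    next
      case 2
      \<comment> \<open>Giving back one inverse pair replaces the bad size 2 by 4. This size is good
        because \<open>?e\<close> is a multiple of 4, hence not 6.\<close>
      have "?e \<noteq> 2" using e2 u 2 m by auto
      then have e4: "\<exists>k\<ge>1. ?e = 4 * k" using e u by auto
      have "m \<noteq> 0"
      proof
        assume "m = 0"
        then show False using el e4 m u 2 by fastforce
      qed
      then have m0: "m > 0" by simp
      have "4 \<le> ?e" "?e \<noteq> 6" using e4 by presburger+
      moreover have "t = 4 + 2 * (m - 1)" using u 2 m0 by linarith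
      ultimately show ?thesis using m by (intro exI[of _ 4] exI[of _ "m - 1"]) auto
    next
      case 3
      \<comment> \<open>Giving back one pair raises the bad size \<open>?e - 2\<close> to
        \<open>?e\<close>, that is, to all of \<open>involutions\<close>.\<close>
      then have "m \<noteq> 0" using el m u e by auto
      then show ?thesis using u m 3 by (intro exI[of _ ?e] exI[of _ "m - 1"]) auto
    qed
  qed
  then obtain t' p where tp: "t = t' + 2 * p" "2 * p \<le> order G - ?e" "t' \<le> ?e" "t' \<noteq> 2"
    "?e \<ge> 3 \<longrightarrow> t' + 2 \<noteq> ?e" by blast
  obtain A where A: "A \<subseteq> involutions" "card A = t'" "set_prod A = \<one>"
    using involution_subset[OF fin tp(3,4)] tp(5) by blast
  obtain B where B: "B \<subseteq> carrier G - involutions" "card B = 2 * p" "set_prod B = \<one>"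
    using inverse_pairs_subset(1)[OF fin] tp(2) card by metis
  have f: "finite A" "finite B" using A B fin fE finite_subset by blast+
  have dis: "A \<inter> B = {}" using A B by blast
  have c: "A \<subseteq> carrier G" "B \<subseteq> carrier G" using A(1) B(1) involutions_carrier by auto
  have "card (A \<union> B) = t" using card_Un_disjoint[OF f dis] A B tp by simp
  moreover have "set_prod (A \<union> B) = \<one>"
    using set_prod_Un_disjoint[OF f dis c] A(3) B(3) by simp
  ultimately show ?thesis using c by blast
qed

text \<open>The product is the unique involution, and this is a square because the squares form a set of size \<open>order G / 2\<close>,
  which is even, and closed under inversion, which cannot fix \<open>\<one>\<close> alone.\<close>
lemma unique_involution_square:
  assumes fin: "finite (carrier G)" and e: "card involutions = 2" and "4 dvd order G"
  shows "\<exists>g\<in>carrier G. set_prod (carrier G) = g \<otimes> g"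
proof -
  obtain x y where xy: "involutions = {x, y}" "x \<noteq> y" using e by (auto simp: card_2_iff)
  define p where "p = (if x = \<one> then y else x)"
  have p: "p \<noteq> \<one>" "involutions = {\<one>, p}" using xy one_involution by (auto simp: p_def)
  have pc: "p \<in> carrier G" "p \<in> involutions" using p involutions_carrier by auto
  let ?\<phi> = "\<lambda>x. x \<otimes> p"
  let ?sq = "\<lambda>x. x \<otimes> x"
  define H where "H = ?sq ` carrier G"
  have inv: "?\<phi> x \<in> carrier G \<and> ?\<phi> (?\<phi> x) = x \<and> ?\<phi> x \<noteq> x" if "x \<in> carrier G" for x
    using that p pc involution_translate involution_translate_neq by auto
  obtain R where R: "R \<subseteq> carrier G" "R \<inter> ?\<phi> ` R = {}" "R \<union> ?\<phi> ` R = carrier G"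
    using involution_transversal[of "carrier G" ?\<phi>, OF fin inv] by blast
  have injR: "inj_on ?\<phi> R" using R(1) inv by (intro involution_inj_on) blast
  have fR: "finite R" using R(1) fin finite_subset by blast
  have card: "order G = 2 * card R"
    using card_involution_pairs[OF fR injR R(2)] R(3) by (simp add: order_def)
  \<comment> \<open>Squaring is constant on each pair \<open>{x, x \<otimes> p}\<close> and
    separates different pairs (\<open>inj\<close> below), so \<open>H\<close> has half the size of
    the group.\<close>
  have sqp: "?sq (?\<phi> x) = ?sq x" if "x \<in> carrier G" for x
  proof -
    have "?sq (?\<phi> x) = ?sq x \<otimes> ?sq p" using that pc by (simp add: m_ac)
    then show ?thesis using that pc by (simp add: involutions_def)
  qed
  have H: "H = ?sq ` R"
  proof -
    have "H = ?sq ` (R \<union> ?\<phi> ` R)" by (simp add: H_def R(3))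
    also have "\<dots> = ?sq ` R" using sqp R(1) by (auto simp: image_Un image_image subset_iff)
    finally show ?thesis .
  qed
  have inj: "inj_on ?sq R"
  proof (rule inj_onI)
    fix x y assume xy: "x \<in> R" "y \<in> R" "x \<otimes> x = y \<otimes> y"
    then have c: "x \<in> carrier G" "y \<in> carrier G" using R by auto
    have "(inv y \<otimes> x) \<otimes> (inv y \<otimes> x) = (inv y \<otimes> inv y) \<otimes> (x \<otimes> x)" using c by (simp add: m_ac)
    also have "\<dots> = (inv y \<otimes> y) \<otimes> (inv y \<otimes> y)" using c xy(3) by (simp add: m_ac)
    finally have "inv y \<otimes> x \<in> involutions" using c by (simp add: involutions_def)
    then consider "inv y \<otimes> x = \<one>" | "inv y \<otimes> x = p" using p by auto
    then show "x = y"
    proof cases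
      case 1
      then show ?thesis using c inv_solve_left'[of \<one> y x] by simp
    next
      case 2
      then have "x = ?\<phi> y" using c pc inv_solve_left'[of p y x] by simp
      then show ?thesis using R(2) xy by blast
    qed
  qed
  have cH: "even (card H)" using assms(3) card inj by (auto simp: H card_image)
  have Hc: "H \<subseteq> carrier G" by (auto simp: H_def)
  have fH: "finite H" using H fR by simp
  have oneH: "\<one> \<in> H" unfolding H_def by (rule image_eqI[of _ _ \<one>]) auto
  have "p \<in> H"
  proof (rule ccontr)
    assume np: "p \<notin> H"
    have "inv x \<in> H - {\<one>} \<and> inv (inv x) = x \<and> inv x \<noteq> x" if x: "x \<in> H - {\<one>}" for x
    proof -
      obtain y where y: "x = y \<otimes> y" "y \<in> carrier G" using x by (auto simp: H_def)
      have xc: "x \<in> carrier G" using x Hc by blast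
      have "inv x = inv y \<otimes> inv y" using y by (simp add: inv_mult)
      then have "inv x \<in> H" using y by (auto simp: H_def)
      moreover have "inv x \<noteq> \<one>" using x xc by (metis DiffE inv_inv inv_one singletonI)
      moreover have "inv x \<noteq> x"
      proof
        assume "inv x = x"
        then have "x \<in> involutions" using xc by (metis (mono_tags, lifting) involutions_def mem_Collect_eq r_inv)
        then show False using x np p by auto
      qed
      ultimately show ?thesis using xc by auto
    qed
    then have "even (card (H - {\<one>}))"
      using even_card_involution[of "H - {\<one>}" "\<lambda>x. inv x"] fH by simp
    moreover have "card H = Suc (card (H - {\<one>}))" using card_Suc_Diff1[OF fH oneH] by simp
    ultimately show False using cH by simp
  qed
  \<comment> \<open>Elements outside \<open>involutions\<close> cancel in inverse pairs; of the rest
    only \<open>p\<close> contributes.\<close>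
  moreover have "set_prod (carrier G) = p"
  proof -
    have c2: "card (carrier G - involutions) = order G - 2"
      using e card_Diff_subset[OF finite_subset[OF involutions_carrier fin] involutions_carrier]
      by (simp add: order_def)
    have "even (order G - 2)" using assms(3) by (auto elim!: dvdE)
    then obtain T where T: "T \<subseteq> carrier G - involutions" "card T = order G - 2" "set_prod T = \<one>"
      using inverse_pairs_subset(1)[OF fin, of "(order G - 2) div 2"] c2 by auto
    then have "T = carrier G - involutions" using c2 fin by (metis card_subset_eq finite_Diff)
    then have "set_prod (carrier G) = set_prod (T \<union> involutions)" using involutions_carrier by (metis Diff_partition Un_commute)
    also have "\<dots> = set_prod T \<otimes> set_prod involutions"
      using T fin finite_subset[OF involutions_carrier fin] finite_subset[of T "carrier G"] involutions_carrier
      by (intro set_prod_Un_disjoint) auto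
    also have "set_prod involutions = p" using p pc by (simp add: finprod_insert)
    finally show ?thesis using T pc by simp
  qed
  ultimately show ?thesis by (auto simp: H_def)
qed

text \<open>An odd prime divisor of the order would be the size of a subgroup, but translation by a
  nonneutral member pairs off the elements of that subgroup.\<close>

lemma elementary_order_power_of_2:
  assumes fin: "finite (carrier G)" and el: "involutions = carrier G"
  shows "\<exists>q. order G = 2 ^ q"
proof -
  have pos: "order G > 0" using fin by (auto simp: order_def card_gt_0_iff)
  obtain m where "order G = 2 ^ multiplicity 2 (order G) * m" "odd m"
    using multiplicity_decompose'[of "order G" 2] pos by auto
  then obtain k where km: "order G = 2 ^ k * m" "odd m" by blast
  have "m = 1"
  proof (rule ccontr)
    assume "m \<noteq> 1"
    then obtain p where p: "prime p" "p dvd m" using prime_factor_nat by blast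
    then have "odd p" using km by auto
    obtain l where "m = p * l" using p by blast
    \<comment> \<open>With exponent 1 the Sylow theorem gives Cauchy's theorem.\<close>
    then have "order G = p ^ 1 * (2 ^ k * l)" using km by simp
    then obtain H where H: "subgroup H G" "card H = p"
      using sylow_thm[OF p(1) is_group _ fin] by fastforce
    interpret S: subgroup H G by fact
    have "card H > 1" using H p prime_gt_1_nat by simp
    then have "\<not> H \<subseteq> {\<one>}" using card_mono[of "{\<one>}" H] by auto
    then obtain x where x: "x \<in> H" "x \<noteq> \<one>" by blast
    have "x \<in> involutions" using x el S.subset by blast
    then have nb: "x \<otimes> x = \<one>" "x \<in> carrier G" by (auto simp: involutions_def)
    have "even (card H)"
    proof (rule even_card_involution[of H "\<lambda>y. y \<otimes> x"])
      show "finite H" using H p prime_gt_0_nat card_ge_0_finite by metis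
      show "y \<otimes> x \<in> H \<and> y \<otimes> x \<otimes> x = y \<and> y \<otimes> x \<noteq> y" if "y \<in> H" for y
        using that x nb by (simp add: m_assoc)
    qed
    then show False using H \<open>odd p\<close> by simp
  qed
  then show ?thesis using km by auto
qed

text \<open>The exceptions are expressed through the order alone, so that they match the two kinds
  of ugly graph. A nonneutral square is used only for the whole group with a unique element of order
  two; otherwise the product is neutral.\<close>

lemma subset_prod_square:
  assumes fin: "finite (carrier G)" and t: "t \<le> order G"
    and 2: "order G mod 4 = 2 \<Longrightarrow> t \<noteq> order G"
    and pow: "\<And>q. q \<ge> 2 \<Longrightarrow> order G = 2 ^ q \<Longrightarrow> t \<noteq> 2 \<and> t + 2 \<noteq> order G"
  shows "\<exists>T\<subseteq>carrier G. card T = t \<and> (\<exists>g\<in>carrier G. set_prod T = g \<otimes> g)"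
proof (cases "card involutions = 2 \<and> t = order G")
  case True
  have "even (order G)"
  proof -
    have "even (card (carrier G - involutions))" using inverse_pairs_subset(2)[OF fin, of 0] by simp
    then show ?thesis using True fin
      by (metis card_Diff_subset card_mono dvd_diffD dvd_refl finite_subset involutions_carrier order_def)
  qed
  then have "4 dvd order G" using 2 True by presburger
  then show ?thesis using unique_involution_square[OF fin] True by (auto simp: order_def)
next
  case False
  have "t \<noteq> 2 \<and> t + 2 \<noteq> order G" if e: "card involutions = order G" "4 \<le> order G"
  proof -
    have "involutions = carrier G" using e fin card_subset_eq involutions_carrier order_def by metis
    then obtain q where q: "order G = 2 ^ q" using elementary_order_power_of_2 fin by blast
    have "q \<ge> 2"
    proof (rule ccontr)
      assume "\<not> q \<ge> 2"
      then have "q = 0 \<or> q = 1" by auto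
      then show False using q e(2) by auto
    qed
    then show ?thesis using pow q by blast
  qed
  then obtain T where "T \<subseteq> carrier G" "card T = t" "set_prod T = \<one>"
    using subset_prod_one[OF fin t] False by blast
  then show ?thesis by (intro exI[of _ T]) (auto intro!: bexI[of _ \<one>])
qed

text \<open>Distinct elements that are their own inverses never cancel. The whole group has product
  one, so the complement of a pair inherits the nontrivial product of the pair.\<close>

lemma elementary_subset_prod_neq_one:
  assumes fin: "finite (carrier G)" and el: "involutions = carrier G" and "order G \<ge> 4"
    and T: "T \<subseteq> carrier G" "card T = 2 \<or> card T + 2 = order G"
  shows "set_prod T \<noteq> \<one>"
proof -
  have two: "set_prod T \<noteq> \<one>" if T: "T \<subseteq> carrier G" "card T = 2" for T
  proof -
    obtain x y where xy: "T = {x, y}" "x \<noteq> y" using T by (auto simp: card_2_iff)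
    have c: "x \<in> involutions" "y \<in> involutions" using xy T el by auto
    have "set_prod T = x \<otimes> y" using xy T by (simp add: finprod_insert)
    moreover have yy: "x \<in> carrier G" "y \<in> carrier G" "y \<otimes> y = \<one>"
      using c by (auto simp: involutions_def)
    moreover have "x = y" if "x \<otimes> y = \<one>"
      using that yy by (metis right_cancel)
    ultimately show ?thesis using xy by auto
  qed
  have fT: "finite T" using T fin finite_subset by blast
  show ?thesis
  proof (cases "card T = 2")
    case False
    have c: "card (carrier G - T) = 2"
      using T False fT by (simp add: card_Diff_subset order_def)
    have "set_prod (carrier G) = \<one>"
      using set_prod_all_involutions(2)[OF fin] el assms(3) by (simp add: order_def)
    moreover have "set_prod (T \<union> (carrier G - T)) = set_prod T \<otimes> set_prod (carrier G - T)"
      using T fT fin by (intro set_prod_Un_disjoint) auto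
    moreover have "T \<union> (carrier G - T) = carrier G" using T by auto
    moreover have "set_prod (carrier G - T) \<in> carrier G" by (rule set_prod_closed) auto
    ultimately show ?thesis using two[OF _ c] by (metis Diff_subset l_one)
  qed (use two T in blast)
qed

end

section \<open>Realizable weights\<close>

inductive parity_walk :: "'a sgraph \<Rightarrow> bool \<Rightarrow> 'a \<Rightarrow> 'a \<Rightarrow> bool" for C where
  parity_walk_refl: "parity_walk C False u u"
| parity_walk_step: "parity_walk C b u v \<Longrightarrow> {v, w} \<in> edges C \<Longrightarrow> parity_walk C (\<not> b) u w"

lemma parity_walk_trans:
  assumes "parity_walk C b v w" and "parity_walk C a u v"
  shows "parity_walk C (a \<noteq> b) u w"
  using assms
proof induction
  case (parity_walk_step b v x y)
  then show ?case using parity_walk.parity_walk_step[of C "a \<noteq> b" u x y] by (cases a; cases b) auto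
qed simp

lemma parity_walk_edge: "{u, v} \<in> edges C \<Longrightarrow> parity_walk C True u v"
  using parity_walk_step[OF parity_walk_refl] by simp

lemma parity_walk_sym: "parity_walk C b u v \<Longrightarrow> parity_walk C b v u"
proof (induction rule: parity_walk.induct)
  case (parity_walk_step b u v w)
  then have "parity_walk C True w v" by (simp add: parity_walk_edge insert_commute)
  from parity_walk_trans[OF parity_walk_step.IH this] show ?case by simp
qed (rule parity_walk_refl)

lemma adj_rtrancl_parity_walk:
  assumes "(u, v) \<in> (adj C)\<^sup>*"
  shows "\<exists>b. parity_walk C b u v"
  using assms
proof induction
  case base
  show ?case by (blast intro: parity_walk_refl)
next
  case (step v w)
  then show ?case by (auto simp: adj_def intro: parity_walk_step)
qed

lemma edge_verts:
  assumes "finite_simple_graph C" and "{u, v} \<in> edges C"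
  shows "u \<in> verts C" "v \<in> verts C" "u \<noteq> v"
proof -
  have "{u, v} \<subseteq> verts C" "card {u, v} = 2" using assms unfolding finite_simple_graph_def by blast+
  then show "u \<in> verts C" "v \<in> verts C" "u \<noteq> v" by auto
qed

lemma finite_verts: "finite_simple_graph C \<Longrightarrow> finite (verts C)"
  by (simp add: finite_simple_graph_def)

lemma finite_edges:
  assumes "finite_simple_graph C"
  shows "finite (edges C)"
proof -
  have "edges C \<subseteq> Pow (verts C)" using assms by (auto simp: finite_simple_graph_def)
  then show ?thesis using finite_verts[OF assms] finite_subset by blast
qed

lemma parity_walk_two_colouring:
  assumes "parity_walk C b u v" and "finite_simple_graph C" and "proper_colouring C 2 c" and "u \<in> verts C"
  shows "v \<in> verts C \<and> b = (c u \<noteq> c v)"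
  using assms(1,4)
proof induction
  case (parity_walk_step b u v w)
  have w: "w \<in> verts C" using edge_verts(2)[OF assms(2)] parity_walk_step by blast
  have "c v < 2" "c u < 2" "c w < 2" "c v \<noteq> c w"
    using assms(3) parity_walk_step w by (auto simp: proper_colouring_def)
  then show ?case using parity_walk_step w by auto
qed simp

text \<open>Colour each vertex by whether an even walk from \<open>r\<close> reaches it. If both
  ends of an edge are reached evenly, an odd closed walk arises; if neither is, an odd walk to one
  end extends to an even walk to the other.\<close>

lemma odd_closed_walk:
  assumes fin: "finite_simple_graph C" and con: "connected_graph C" and r: "r \<in> verts C"
    and "\<not> (\<exists>c. proper_colouring C 2 c)"
  shows "parity_walk C True r r"
proof (rule ccontr)
  assume no: "\<not> parity_walk C True r r"
  define c :: "'a \<Rightarrow> nat" where "c v = (if parity_walk C False r v then 0 else 1)" for v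
  have "c u \<noteq> c v" if e: "{u, v} \<in> edges C" for u v
  proof
    assume eq: "c u = c v"
    obtain b where b: "parity_walk C b r u"
      using con edge_verts(1)[OF fin e] r adj_rtrancl_parity_walk unfolding connected_graph_def by metis
    have step: "parity_walk C (\<not> b) r v" using b e by (rule parity_walk_step)
    show False
    proof (cases "parity_walk C False r u")
      case True
      then have "parity_walk C False r v" using eq by (simp add: c_def split: if_splits)
      moreover have "parity_walk C True r v" using parity_walk_step[OF True e] by simp
      ultimately show False using no parity_walk_trans[OF parity_walk_sym] by fastforce
    next
      case False
      then have "\<not> parity_walk C False r v" using eq by (simp add: c_def split: if_splits)
      then show False using step b False by (cases b) auto
    qed
  qed
  then have "proper_colouring C 2 c" by (auto simp: proper_colouring_def c_def)
  then show False using assms(4) by blast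
qed

section \<open>Vertex weights that come from edge labels\<close>

context comm_group
begin

definition realizable :: "'c sgraph \<Rightarrow> ('c \<Rightarrow> 'a) \<Rightarrow> bool" where
  "realizable C w \<longleftrightarrow>
     (\<exists>f\<in>edges C \<rightarrow> carrier G. \<forall>v\<in>verts C. weighted_degree G C f v = w v)"

definition single :: "'c \<Rightarrow> 'a \<Rightarrow> 'c \<Rightarrow> 'a" where
  "single u x z = (if z = u then x else \<one>)"

lemma single_one: "single u \<one> = (\<lambda>z. \<one>)"
  by (auto simp: single_def)

lemma realizable_cong:
  assumes "realizable C w" and "\<And>v. v \<in> verts C \<Longrightarrow> w v = w' v"
  shows "realizable C w'"
  using assms by (auto simp: realizable_def)

lemma realizable_one: "realizable C (\<lambda>v. \<one>)"
  unfolding realizable_def weighted_degree_def by (rule bexI[of _ "\<lambda>e. \<one>"]) auto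

lemma realizable_mult:
  assumes "realizable C w" and "realizable C w'"
  shows "realizable C (\<lambda>v. w v \<otimes> w' v)"
proof -
  obtain f g where f: "f \<in> edges C \<rightarrow> carrier G" "\<forall>v\<in>verts C. weighted_degree G C f v = w v"
    and g: "g \<in> edges C \<rightarrow> carrier G" "\<forall>v\<in>verts C. weighted_degree G C g v = w' v"
    using assms by (auto simp: realizable_def)
  have "weighted_degree G C (\<lambda>e. f e \<otimes> g e) v = weighted_degree G C f v \<otimes> weighted_degree G C g v" for v
    unfolding weighted_degree_def using f(1) g(1) by (intro finprod_multf) auto
  then show ?thesis unfolding realizable_def using f g by (intro bexI[of _ "\<lambda>e. f e \<otimes> g e"]) auto
qed

lemma realizable_edge:
  assumes fin: "finite_simple_graph C" and e: "{u, v} \<in> edges C" and x: "x \<in> carrier G"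
  shows "realizable C (\<lambda>z. single u x z \<otimes> single v x z)"
proof -
  define f where "f e = (if e = {u, v} then x else \<one>)" for e
  have "weighted_degree G C f z = single u x z \<otimes> single v x z" for z
  proof (cases "z \<in> {u, v}")
    case True
    have "weighted_degree G C f z = x"
      unfolding weighted_degree_def f_def
      using finprod_singleton_swap[of "{u, v}" "{e \<in> edges C. z \<in> e}" "\<lambda>_. x"] finite_edges[OF fin] x e True
      by auto
    then show ?thesis using True edge_verts(3)[OF fin e] x by (auto simp: single_def)
  next
    case False
    then have "weighted_degree G C f z = \<one>"
      unfolding weighted_degree_def f_def by (intro finprod_one_eqI) auto
    then show ?thesis using False by (auto simp: single_def)
  qed
  moreover have "f \<in> edges C \<rightarrow> carrier G" using x by (auto simp: f_def)
  ultimately show ?thesis unfolding realizable_def by blast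
qed

text \<open>The labels alternate between \<open>x\<close> and \<open>inv x\<close> and cancel at
  inner vertices. For an odd closed walk the ends coincide, which leaves the square
  \<open>x \<otimes> x\<close> at a single vertex.\<close>

lemma realizable_parity_walk:
  assumes "parity_walk C b u v" and fin: "finite_simple_graph C" and x: "x \<in> carrier G"
  shows "realizable C (\<lambda>z. single u x z \<otimes> single v (if b then x else inv x) z)"
  using assms(1)
proof induction
  case (parity_walk_refl u)
  show ?case by (rule realizable_cong[OF realizable_one]) (use x in \<open>auto simp: single_def\<close>)
next
  case (parity_walk_step b u v w)
  define y where "y = (if b then x else inv x)"
  have y: "y \<in> carrier G" "inv y = (if \<not> b then x else inv x)" using x by (auto simp: y_def)
  have "realizable C (\<lambda>z. (single u x z \<otimes> single v y z) \<otimes> (single v (inv y) z \<otimes> single w (inv y) z))"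
    using realizable_mult[OF parity_walk_step.IH[folded y_def]
        realizable_edge[OF fin parity_walk_step.hyps(2), of "inv y"]] y(1) by simp
  then have "realizable C (\<lambda>z. single u x z \<otimes> single w (inv y) z)"
  proof (rule realizable_cong)
    fix z
    show "(single u x z \<otimes> single v y z) \<otimes> (single v (inv y) z \<otimes> single w (inv y) z)
      = single u x z \<otimes> single w (inv y) z"
      using x y(1) by (auto simp: single_def m_assoc[symmetric]) (simp_all add: m_assoc)
  qed
  then show ?case using y(2) by simp
qed

text \<open>All weights can be moved to the root \<open>r\<close> along walks; \<open>\<epsilon> v\<close> is the parity of a walk from
  \<open>v\<close> to \<open>r\<close>, hence decides the sign with which \<open>w v\<close> arrives.\<close>
lemma realizable_root:
  assumes fin: "finite_simple_graph C" and walk: "\<And>v. v \<in> verts C \<Longrightarrow> parity_walk C (\<epsilon> v) v r"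
    and w: "w \<in> verts C \<rightarrow> carrier G"
    and root: "realizable C (single r (finprod G (\<lambda>v. if \<epsilon> v then inv (w v) else w v) (verts C)))"
  shows "realizable C w"
proof -
  let ?s = "\<lambda>v. if \<epsilon> v then inv (w v) else w v"
  have s: "?s \<in> verts C \<rightarrow> carrier G" using w by (auto simp: Pi_iff)
  \<comment> \<open>Invariant: the weights on \<open>S\<close> are realized at the price of a
    compensating weight at \<open>r\<close>, which the assumption \<open>root\<close> cancels at the
    end.\<close>
  have "realizable C (\<lambda>z. (if z \<in> S then w z else \<one>) \<otimes> single r (inv (finprod G ?s S)) z)"
    if "finite S" "S \<subseteq> verts C" for S
    using that
  proof induction
    case empty
    show ?case by (rule realizable_cong[OF realizable_one]) (auto simp: single_def)
  next
    case (insert v S)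
    define x where "x = w v"
    define p where "p = finprod G ?s S"
    have x: "x \<in> carrier G" and p: "p \<in> carrier G" using insert.prems w s by (auto simp: x_def p_def intro!: finprod_closed)
    have "finprod G ?s (insert v S) = ?s v \<otimes> finprod G ?s S"
      using insert.hyps insert.prems w by (intro finprod_insert) (auto simp: Pi_iff subset_iff)
    then have ip: "inv (finprod G ?s (insert v S)) = inv p \<otimes> (if \<epsilon> v then x else inv x)"
      using x p by (auto simp: x_def p_def inv_mult m_comm)
    have "realizable C (\<lambda>z. ((if z \<in> S then w z else \<one>) \<otimes> single r (inv p) z) \<otimes>
        (single v x z \<otimes> single r (if \<epsilon> v then x else inv x) z))"
      using realizable_mult[OF _ realizable_parity_walk[OF walk fin x, of v]] insert.IH insert.prems
      by (auto simp: p_def)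
    then show ?case
    proof (rule realizable_cong)
      fix z assume z: "z \<in> verts C"
      have wz: "w z \<in> carrier G" using w z by auto
      show "((if z \<in> S then w z else \<one>) \<otimes> single r (inv p) z) \<otimes>
          (single v x z \<otimes> single r (if \<epsilon> v then x else inv x) z)
        = (if z \<in> insert v S then w z else \<one>) \<otimes> single r (inv (finprod G ?s (insert v S))) z"
        unfolding ip using x p wz insert.hyps by (auto simp: single_def x_def m_ac)
    qed
  qed
  from realizable_mult[OF this[OF finite_verts[OF fin] subset_refl] root]
  show ?thesis
  proof (rule realizable_cong)
    fix z assume z: "z \<in> verts C"
    have "w z \<in> carrier G" using w z by auto
    moreover have "finprod G ?s (verts C) \<in> carrier G" using s by (rule finprod_closed)
    ultimately show "(if z \<in> verts C then w z else \<one>) \<otimes> single r (inv (finprod G ?s (verts C))) z \<otimes>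
        single r (finprod G ?s (verts C)) z = w z"
      using z by (auto simp: single_def m_assoc)
  qed
qed

text \<open>An odd closed walk lets every vertex reach \<open>r\<close> by an even walk, so no
  weight is inverted, and the same closed walk supplies \<open>g \<otimes> g\<close> at
  \<open>r\<close>. If all elements are their own inverses, signs are immaterial and the total is
  neutral; this alternative serves the group of order two, where \<open>C\<close> may be
  bipartite.\<close>

lemma realizable_square:
  assumes fin: "finite_simple_graph C" and con: "connected_graph C" and r: "r \<in> verts C"
    and odd: "parity_walk C True r r \<or> involutions = carrier G"
    and w: "w \<in> verts C \<rightarrow> carrier G" and g: "g \<in> carrier G" "finprod G w (verts C) = g \<otimes> g"
  shows "realizable C w"
proof -
  have "\<exists>b. parity_walk C b v r" if "v \<in> verts C" for v
    using con that r adj_rtrancl_parity_walk unfolding connected_graph_def by metis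
  then obtain \<epsilon> where \<epsilon>: "\<And>v. v \<in> verts C \<Longrightarrow> parity_walk C (\<epsilon> v) v r" by metis
  show ?thesis
  proof (cases "parity_walk C True r r")
    case True
    have even: "parity_walk C False v r" if "v \<in> verts C" for v
      using \<epsilon>[OF that] parity_walk_trans[OF True, of "\<epsilon> v" v] by (cases "\<epsilon> v") auto
    have "realizable C (single r (g \<otimes> g))"
      using realizable_parity_walk[OF True fin g(1)]
      by (rule realizable_cong) (auto simp: single_def)
    then show ?thesis using realizable_root[OF fin even w] g by simp
  next
    case False
    then have el: "involutions = carrier G" using odd by blast
    have sq: "x \<otimes> x = \<one>" if "x \<in> carrier G" for x
      using that unfolding el[symmetric] by (simp add: involutions_def)
    then have inv: "inv x = x" if "x \<in> carrier G" for x using that by (simp add: inv_equality)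
    have "finprod G (\<lambda>v. if \<epsilon> v then inv (w v) else w v) (verts C) = finprod G w (verts C)"
      using w inv by (intro finprod_cong') auto
    also have "\<dots> = \<one>" using g sq by simp
    finally have "realizable C (single r (finprod G (\<lambda>v. if \<epsilon> v then inv (w v) else w v) (verts C)))"
      by (simp add: single_one realizable_one)
    then show ?thesis using realizable_root[OF fin \<epsilon> w] by blast
  qed
qed

lemma realizable_imp_vertex_group_colouring:
  assumes "finite_simple_graph C" and "realizable C w" and "\<And>u v. {u, v} \<in> edges C \<Longrightarrow> w u \<noteq> w v"
  shows "\<exists>f. vertex_group_colouring G C f"
proof -
  obtain f where "f \<in> edges C \<rightarrow> carrier G" "\<forall>v\<in>verts C. weighted_degree G C f v = w v"
    using assms(2) by (auto simp: realizable_def)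
  then have "vertex_group_colouring G C f"
    unfolding vertex_group_colouring_def using assms(1,3) edge_verts by metis
  then show ?thesis by blast
qed

text \<open>The first value avoids both \<one> and \<open>z\<close>, which takes three group
  elements. The product left over is then not \<one>, as required when a single point
  remains.\<close>

lemma nonidentity_finprod:
  assumes ord: "order G \<ge> 3" and "finite X" and "card X \<ge> 2" and "z \<in> carrier G"
  shows "\<exists>h\<in>X \<rightarrow> carrier G - {\<one>}. finprod G h X = z"
  using assms(2-4)
proof (induction X arbitrary: z)
  case (insert x X)
  have "card {\<one>, z} < card (carrier G)" using ord by (auto simp: order_def card_insert_if)
  then have "\<not> carrier G \<subseteq> {\<one>, z}" using card_mono[of "{\<one>, z}" "carrier G"] by auto
  then obtain a where a: "a \<in> carrier G" "a \<noteq> \<one>" "a \<noteq> z" by blast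
  have az: "inv a \<otimes> z \<in> carrier G" "a \<otimes> (inv a \<otimes> z) = z"
    using a insert.prems by (auto simp: m_assoc[symmetric])
  have "\<exists>h\<in>X \<rightarrow> carrier G - {\<one>}. finprod G h X = inv a \<otimes> z"
  proof (cases "card X \<ge> 2")
    case True
    then show ?thesis using insert.IH az by blast
  next
    case False
    then have "card X = 1" using insert by simp
    then obtain y where y: "X = {y}" by (auto simp: card_1_singleton_iff)
    have "inv a \<otimes> z \<noteq> \<one>" using a insert.prems az by (metis r_one)
    then show ?thesis using az y by (intro bexI[of _ "\<lambda>_. inv a \<otimes> z"]) (auto simp: finprod_insert)
  qed
  then obtain h where h: "h \<in> X \<rightarrow> carrier G - {\<one>}" "finprod G h X = inv a \<otimes> z" by blast
  define h' where "h' = h(x := a)"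
  have "finprod G h' X = finprod G h X" using h(1) insert.hyps by (intro finprod_cong') (auto simp: h'_def)
  moreover have h': "h' \<in> insert x X \<rightarrow> carrier G - {\<one>}" using h a by (auto simp: h'_def Pi_iff)
  moreover have "finprod G h' (insert x X) = h' x \<otimes> finprod G h' X"
    using insert.hyps h' by (intro finprod_insert) auto
  ultimately have "finprod G h' (insert x X) = z" using h az by (simp add: h'_def)
  then show ?case using h' by blast
qed simp

lemma finprod_inv_one:
  assumes "h \<in> A \<rightarrow> carrier G" and "finprod G h A = \<one>"
  shows "finprod G (\<lambda>v. inv (h v)) A = \<one>"
proof -
  have i: "(\<lambda>v. inv (h v)) \<in> A \<rightarrow> carrier G" using assms by auto
  have "finprod G (\<lambda>v. inv (h v) \<otimes> h v) A = \<one>"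
    by (rule finprod_one_eqI) (use assms(1) in \<open>auto simp: Pi_iff\<close>)
  then show ?thesis using finprod_multf[OF i assms(1)] assms(2) finprod_closed[OF i] by simp
qed

text \<open>One side carries nonneutral weights of product one, the other side only \<one>, so both
  totals agree. The first side needs two vertices, and three vertices in all guarantee such a
  side.\<close>

lemma bipartite_vertex_group_colouring:
  assumes fin: "finite_simple_graph C" and con: "connected_graph C" and "card (verts C) \<ge> 3"
    and c: "proper_colouring C 2 c" and ord: "order G \<ge> 3"
  shows "\<exists>f. vertex_group_colouring G C f"
proof -
  have fV: "finite (verts C)" using finite_verts[OF fin] .
  have c2: "c v < 2" if "v \<in> verts C" for v using c that by (auto simp: proper_colouring_def)
  have "verts C = colour_class C c 0 \<union> colour_class C c 1"
    using c2 by (force simp: colour_class_def)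
  then have "card (verts C) \<le> card (colour_class C c 0) + card (colour_class C c 1)"
    by (metis card_Un_le)
  then have "card (colour_class C c 0) \<ge> 2 \<or> card (colour_class C c 1) \<ge> 2"
    using assms(3) by linarith
  then obtain a where a: "a < 2" "card (colour_class C c a) \<ge> 2"
    by (metis one_less_numeral_iff semiring_norm(76) zero_less_numeral)
  define X where "X = colour_class C c a"
  have X: "finite X" "X \<subseteq> verts C" using fV by (auto simp: X_def colour_class_def)
  obtain h where h: "h \<in> X \<rightarrow> carrier G - {\<one>}" "finprod G h X = \<one>"
    using nonidentity_finprod[OF ord X(1), of \<one>] a by (auto simp: X_def)
  define w where "w v = (if v \<in> X then h v else \<one>)" for v
  have w: "w \<in> verts C \<rightarrow> carrier G" using h by (auto simp: w_def)
  obtain r where r: "r \<in> verts C" using con by (auto simp: connected_graph_def)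
  define \<epsilon> where "\<epsilon> v \<longleftrightarrow> c v \<noteq> c r" for v
  have walk: "parity_walk C (\<epsilon> v) v r" if v: "v \<in> verts C" for v
  proof -
    obtain b where b: "parity_walk C b v r"
      using con v r adj_rtrancl_parity_walk unfolding connected_graph_def by metis
    then show ?thesis using parity_walk_two_colouring[OF b fin c v] by (simp add: \<epsilon>_def)
  qed
  have "finprod G (\<lambda>v. if \<epsilon> v then inv (w v) else w v) (verts C) = finprod G (\<lambda>v. if \<epsilon> v then inv (h v) else h v) X"
    using h X fV w by (intro finprod_mono_neutral_cong_right) (auto simp: w_def Pi_iff)
  \<comment> \<open>All of \<open>X\<close> has one colour, so the sign is constant there, and
    inverting every weight keeps the product equal to one.\<close>
  also have "\<dots> = finprod G (\<lambda>v. if a \<noteq> c r then inv (h v) else h v) X"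
    using h by (intro finprod_cong') (auto simp: X_def colour_class_def \<epsilon>_def Pi_iff)
  also have "\<dots> = \<one>"
    using finprod_inv_one[of h X] h by (cases "a = c r") auto
  finally have "realizable C (single r (finprod G (\<lambda>v. if \<epsilon> v then inv (w v) else w v) (verts C)))"
    by (simp add: single_one realizable_one)
  then have "realizable C w" using realizable_root[OF fin walk w] by blast
  moreover have "w u \<noteq> w v" if e: "{u, v} \<in> edges C" for u v
  proof -
    have "u \<in> verts C" "v \<in> verts C" "c u \<noteq> c v"
      using edge_verts[OF fin e] c e by (auto simp: proper_colouring_def)
    then have "(u \<in> X) \<noteq> (v \<in> X)" using c2[of u] c2[of v] a(1) by (auto simp: X_def colour_class_def)
    then show ?thesis using h by (auto simp: w_def)
  qed
  ultimately show ?thesis by (rule realizable_imp_vertex_group_colouring[OF fin])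
qed

text \<open>The handshake argument: each label contributes at exactly two vertices. Hence the total
  weight of any labelling is a square.\<close>

lemma finprod_weighted_degree:
  assumes fin: "finite_simple_graph C" and f: "f \<in> edges C \<rightarrow> carrier G"
  shows "finprod G (weighted_degree G C f) (verts C) = finprod G f (edges C) \<otimes> finprod G f (edges C)"
proof -
  have "finprod G (\<lambda>v. finprod G f {e \<in> F. v \<in> e}) (verts C) = finprod G f F \<otimes> finprod G f F"
    if "finite F" "F \<subseteq> edges C" for F
    using that
  proof induction
    case (insert e F)
    have ec: "f e \<in> carrier G" using insert.prems f by auto
    have fF: "f \<in> F \<rightarrow> carrier G" using insert.prems f by auto
    have eV: "e \<subseteq> verts C" "card e = 2" using insert.prems fin by (auto simp: finite_simple_graph_def)
    have step: "finprod G f {e' \<in> insert e F. v \<in> e'} = (if v \<in> e then f e else \<one>) \<otimes> finprod G f {e' \<in> F. v \<in> e'}" for v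
    proof (cases "v \<in> e")
      case True
      then have "{e' \<in> insert e F. v \<in> e'} = insert e {e' \<in> F. v \<in> e'}" by auto
      then show ?thesis using True insert.hyps ec fF by (simp add: finprod_insert Pi_iff)
    next
      case False
      then have "{e' \<in> insert e F. v \<in> e'} = {e' \<in> F. v \<in> e'}" by auto
      moreover have "finprod G f {e' \<in> F. v \<in> e'} \<in> carrier G" using fF by (intro finprod_closed) auto
      ultimately show ?thesis using False by simp
    qed
    have "finprod G (\<lambda>v. if v \<in> e then f e else \<one>) (verts C) = finprod G (\<lambda>v. f e) e"
      using eV ec finite_verts[OF fin] by (intro finprod_mono_neutral_cong_right) auto
    also have "\<dots> = f e \<otimes> f e" using eV ec by (simp add: finprod_const numeral_2_eq_2)
    finally have ends: "finprod G (\<lambda>v. if v \<in> e then f e else \<one>) (verts C) = f e \<otimes> f e" .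
    have fFc: "finprod G f F \<in> carrier G" using fF by (rule finprod_closed)
    have ins: "finprod G f (insert e F) = f e \<otimes> finprod G f F"
      using insert.hyps ec fF by (intro finprod_insert) auto
    have "finprod G (\<lambda>v. finprod G f {e' \<in> insert e F. v \<in> e'}) (verts C)
      = finprod G (\<lambda>v. if v \<in> e then f e else \<one>) (verts C) \<otimes> finprod G (\<lambda>v. finprod G f {e' \<in> F. v \<in> e'}) (verts C)"
      unfolding step using ec fF by (intro finprod_multf) (auto intro!: finprod_closed)
    also have "\<dots> = finprod G f (insert e F) \<otimes> finprod G f (insert e F)"
      unfolding ends ins using insert ec fFc by (simp add: m_ac)
    finally show ?case .
  qed simp
  from this[OF finite_edges[OF fin] subset_refl] show ?thesis by (simp add: weighted_degree_def[abs_def])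
qed

text \<open>Two vertices of equal weight contribute a square, so modulo squares only values with odd
  fibres survive. In the induction a new vertex toggles the membership of its value in this
  set.\<close>

lemma finprod_odd_fibres:
  assumes "finite V" and "w \<in> V \<rightarrow> carrier G"
  shows "\<exists>g\<in>carrier G. finprod G w V = set_prod {x. odd (card {v \<in> V. w v = x})} \<otimes> (g \<otimes> g)"
  using assms
proof induction
  case empty
  show ?case by (rule bexI[of _ \<one>]) auto
next
  case (insert v V)
  define T where "T = {x. odd (card {u \<in> V. w u = x})}"
  define T' where "T' = {x. odd (card {u \<in> insert v V. w u = x})}"
  define x where "x = w v"
  have x: "x \<in> carrier G" using insert.prems by (auto simp: x_def)
  have "T \<subseteq> w ` V"
  proof
    fix y assume "y \<in> T"
    then have "card {u \<in> V. w u = y} \<noteq> 0" by (intro notI) (simp add: T_def)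
    then have "{u \<in> V. w u = y} \<noteq> {}" by (metis card.empty)
    then show "y \<in> w ` V" by auto
  qed
  then have T: "finite T" "T \<subseteq> carrier G" using insert finite_subset by auto
  have card: "card {u \<in> insert v V. w u = y} = (if y = x then Suc (card {u \<in> V. w u = y}) else card {u \<in> V. w u = y})" for y
  proof -
    have "{u \<in> insert v V. w u = y} = (if y = x then insert v {u \<in> V. w u = y} else {u \<in> V. w u = y})"
      by (auto simp: x_def)
    then show ?thesis using insert.hyps by simp
  qed
  obtain g where g: "g \<in> carrier G" "finprod G w V = set_prod T \<otimes> (g \<otimes> g)"
    using insert unfolding T_def by auto
  have ins: "finprod G w (insert v V) = x \<otimes> finprod G w V"
    unfolding x_def using insert by (intro finprod_insert) auto
  have "\<exists>g'\<in>carrier G. finprod G w (insert v V) = set_prod T' \<otimes> (g' \<otimes> g')"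
  proof (cases "x \<in> T")
    case True
    have T': "T' = T - {x}" using True unfolding T'_def card by (auto simp: T_def)
    have c: "set_prod (T - {x}) \<in> carrier G" using T by (intro set_prod_closed) auto
    have "set_prod T = x \<otimes> set_prod (T - {x})"
      using set_prod_insert[of "T - {x}" x] T True by (simp add: insert_absorb)
    then have "finprod G w (insert v V) = set_prod (T - {x}) \<otimes> ((x \<otimes> g) \<otimes> (x \<otimes> g))"
      unfolding ins g(2) using c x g(1) by (simp add: m_ac)
    then show ?thesis unfolding T' using x g by (intro bexI[of _ "x \<otimes> g"]) auto
  next
    case False
    have T': "T' = insert x T" using False unfolding T'_def card by (auto simp: T_def)
    have c: "set_prod T \<in> carrier G" using T by (intro set_prod_closed) auto
    have "set_prod T' = x \<otimes> set_prod T" unfolding T' using T x False by (intro set_prod_insert) auto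
    then show ?thesis unfolding ins g(2) using c x g(1) by (intro bexI[of _ g]) (auto simp: m_assoc)
  qed
  then show ?case unfolding T'_def .
qed

lemma odd_fibres_eq_image:
  assumes "bij_betw \<beta> {..<s} (carrier G)" and "c \<in> verts C \<rightarrow> {..<s}"
    and "\<And>v. v \<in> verts C \<Longrightarrow> w v = \<beta> (c v)"
  shows "{x. odd (card {v \<in> verts C. w v = x})} = \<beta> ` odd_classes C s c"
proof -
  have inj: "inj_on \<beta> {..<s}" using assms(1) by (rule bij_betw_imp_inj_on)
  have cl: "{v \<in> verts C. w v = \<beta> i} = colour_class C c i" if "i < s" for i
    using assms(2,3) inj that by (fastforce simp: colour_class_def inj_on_def)
  show ?thesis
  proof (rule subset_antisym; rule subsetI)
    fix x assume "x \<in> {x. odd (card {v \<in> verts C. w v = x})}"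
    then have x: "odd (card {v \<in> verts C. w v = x})" by simp
    then have "{v \<in> verts C. w v = x} \<noteq> {}" by (metis card.empty even_zero)
    then obtain v where "v \<in> verts C" "w v = x" by blast
    then have "x = \<beta> (c v)" "c v < s" using assms(2,3) by auto
    then show "x \<in> \<beta> ` odd_classes C s c" using x cl by (auto simp: odd_classes_def)
  next
    fix x assume "x \<in> \<beta> ` odd_classes C s c"
    then show "x \<in> {x. odd (card {v \<in> verts C. w v = x})}" using cl by (auto simp: odd_classes_def)
  qed
qed

text \<open>Necessity. Weighted degrees, numbered by a bijection, form a proper colouring. Their
  total is a square by the handshake argument and equals the product of \<open>T\<close> up to a
  square, so that product is a square too.\<close>

lemma vertex_group_colouring_imp_odd_classes:
  assumes fin: "finite_simple_graph C" and finG: "finite (carrier G)" and f: "vertex_group_colouring G C f"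
  shows "\<exists>c T. proper_colouring C (order G) c \<and> T \<subseteq> carrier G \<and> card T = card (odd_classes C (order G) c) \<and>
    (\<exists>g\<in>carrier G. set_prod T = g \<otimes> g)"
proof -
  let ?s = "order G"
  let ?w = "weighted_degree G C f"
  have fc: "f \<in> edges C \<rightarrow> carrier G" using f by (simp add: vertex_group_colouring_def)
  have wc: "?w v \<in> carrier G" for v unfolding weighted_degree_def using fc by (intro finprod_closed) auto
  obtain \<beta> where \<beta>: "bij_betw \<beta> {..<?s} (carrier G)"
    using ex_bij_betw_nat_finite[OF finG] by (auto simp: order_def atLeast0LessThan)
  define c where "c v = inv_into {..<?s} \<beta> (?w v)" for v
  have c: "c v < ?s" "?w v = \<beta> (c v)" for v
    using \<beta> wc[of v] by (auto simp: c_def bij_betw_def inv_into_into f_inv_into_f)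
      (metis inv_into_into lessThan_iff)
  have pcol: "proper_colouring C ?s c"
    using f c by (auto simp: proper_colouring_def vertex_group_colouring_def) metis
  define T where "T = \<beta> ` odd_classes C ?s c"
  have sub: "odd_classes C ?s c \<subseteq> {..<?s}" by (auto simp: odd_classes_def)
  have Tc: "T \<subseteq> carrier G" using \<beta> sub by (auto simp: T_def bij_betw_def)
  have cT: "card T = card (odd_classes C ?s c)"
    unfolding T_def using \<beta> sub by (intro card_image) (metis bij_betw_imp_inj_on inj_on_subset)
  have T: "{x. odd (card {v \<in> verts C. ?w v = x})} = T"
    unfolding T_def by (rule odd_fibres_eq_image[OF \<beta>]) (use c in auto)
  obtain g where g: "g \<in> carrier G" "finprod G ?w (verts C) = set_prod T \<otimes> (g \<otimes> g)"
    using finprod_odd_fibres[OF finite_verts[OF fin], of ?w] wc unfolding T by auto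
  define h where "h = finprod G f (edges C)"
  have h: "h \<in> carrier G" using fc by (simp add: h_def)
  have Tp: "set_prod T \<in> carrier G" using Tc by (rule set_prod_closed)
  have hh: "h \<otimes> h = set_prod T \<otimes> (g \<otimes> g)" using finprod_weighted_degree[OF fin fc] g by (simp add: h_def)
  have "(h \<otimes> inv g) \<otimes> (h \<otimes> inv g) = (h \<otimes> h) \<otimes> (inv g \<otimes> inv g)"
    using h g by (simp add: m_ac)
  also have "\<dots> = (set_prod T \<otimes> (g \<otimes> g)) \<otimes> (inv g \<otimes> inv g)" by (simp only: hh)
  also have "\<dots> = set_prod T \<otimes> ((g \<otimes> inv g) \<otimes> (g \<otimes> inv g))" using Tp g(1) by (simp only: m_ac inv_closed m_closed)
  also have "\<dots> = set_prod T" using Tp g by simp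
  finally have "set_prod T = (h \<otimes> inv g) \<otimes> (h \<otimes> inv g)" by simp
  then show ?thesis using pcol Tc cT h g by blast
qed

text \<open>Sufficiency. The bijection from colours to group elements is glued from two pieces so
  that the odd classes go exactly onto \<open>T\<close>; the total of the resulting weights is then
  a square.\<close>

lemma odd_classes_imp_vertex_group_colouring:
  assumes fin: "finite_simple_graph C" and con: "connected_graph C" and r: "r \<in> verts C"
    and odd: "parity_walk C True r r \<or> involutions = carrier G"
    and finG: "finite (carrier G)" and c: "proper_colouring C (order G) c"
    and T: "T \<subseteq> carrier G" "card T = card (odd_classes C (order G) c)"
    and g: "g \<in> carrier G" "set_prod T = g \<otimes> g"
  shows "\<exists>f. vertex_group_colouring G C f"
proof -
  let ?s = "order G"
  define U where "U = odd_classes C ?s c"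
  have U: "U \<subseteq> {..<?s}" "finite U" by (auto simp: odd_classes_def U_def)
  have fT: "finite T" using T finG finite_subset by blast
  obtain \<beta>1 where 1: "bij_betw \<beta>1 U T"
    using finite_same_card_bij[OF U(2) fT] T by (auto simp: U_def)
  have "card ({..<?s} - U) = card (carrier G - T)"
    using U T fT finG by (simp add: card_Diff_subset U_def order_def)
  then obtain \<beta>2 where 2: "bij_betw \<beta>2 ({..<?s} - U) (carrier G - T)"
    using finite_same_card_bij[of "{..<?s} - U" "carrier G - T"] finG by auto
  define \<beta> where "\<beta> i = (if i \<in> U then \<beta>1 i else \<beta>2 i)" for i
  have b1: "bij_betw \<beta> U T" using 1 by (rule bij_betw_cong[THEN iffD1, rotated]) (auto simp: \<beta>_def)
  have b2: "bij_betw \<beta> ({..<?s} - U) (carrier G - T)"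
    using 2 by (rule bij_betw_cong[THEN iffD1, rotated]) (auto simp: \<beta>_def)
  have "bij_betw \<beta> (U \<union> ({..<?s} - U)) (T \<union> (carrier G - T))"
    using b1 b2 by (rule bij_betw_combine) auto
  moreover have "U \<union> ({..<?s} - U) = {..<?s}" "T \<union> (carrier G - T) = carrier G" using U T by auto
  ultimately have \<beta>: "bij_betw \<beta> {..<?s} (carrier G)" by simp
  define w where "w v = \<beta> (c v)" for v
  have cs: "c \<in> verts C \<rightarrow> {..<?s}" using c by (simp add: proper_colouring_def)
  have w: "w \<in> verts C \<rightarrow> carrier G" using cs \<beta> by (auto simp: w_def bij_betw_def Pi_iff)
  have "{x. odd (card {v \<in> verts C. w v = x})} = T"
    using odd_fibres_eq_image[OF \<beta> cs, of w] b1 by (auto simp: w_def U_def bij_betw_def)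
  then obtain k where k: "k \<in> carrier G" "finprod G w (verts C) = (g \<otimes> g) \<otimes> (k \<otimes> k)"
    using finprod_odd_fibres[OF finite_verts[OF fin] w] g by auto
  have "finprod G w (verts C) = (g \<otimes> k) \<otimes> (g \<otimes> k)" using k g by (simp add: m_ac)
  then have "realizable C w" using realizable_square[OF fin con r odd w, of "g \<otimes> k"] g k by simp
  moreover have "w u \<noteq> w v" if e: "{u, v} \<in> edges C" for u v
  proof -
    have "c u < ?s" "c v < ?s" "c u \<noteq> c v" using edge_verts[OF fin e] c e by (auto simp: proper_colouring_def)
    then show ?thesis using \<beta> by (auto simp: w_def bij_betw_def inj_on_def)
  qed
  ultimately show ?thesis by (rule realizable_imp_vertex_group_colouring[OF fin])
qed

end

section \<open>Parities of colour classes\<close>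

lemma chromatic_number_colouring:
  assumes "finite (verts C)" and "\<And>u v. {u, v} \<in> edges C \<Longrightarrow> u \<in> verts C \<and> v \<in> verts C \<and> u \<noteq> v"
  shows "\<exists>c. proper_colouring C (chromatic_number C) c"
proof -
  obtain h where h: "bij_betw h (verts C) {0..<card (verts C)}"
    using ex_bij_betw_finite_nat[OF assms(1)] by blast
  have "proper_colouring C (card (verts C)) h"
    using h assms(2) unfolding proper_colouring_def bij_betw_def inj_on_def by fastforce
  then have "\<exists>k c. proper_colouring C k c" by blast
  then show ?thesis unfolding chromatic_number_def by (rule LeastI_ex)
qed

lemma chromatic_number_le: "proper_colouring C k c \<Longrightarrow> chromatic_number C \<le> k"
  unfolding chromatic_number_def by (rule Least_le) blast

lemma proper_colouring_mono: "proper_colouring C k c \<Longrightarrow> k \<le> s \<Longrightarrow> proper_colouring C s c"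
  by (auto simp: proper_colouring_def Pi_iff)

lemma chromatic_colour_class_nonempty:
  assumes fin: "finite_simple_graph C" and c: "proper_colouring C (chromatic_number C) c"
    and i: "i < chromatic_number C"
  shows "colour_class C c i \<noteq> {}"
proof
  assume "colour_class C c i = {}"
  then have no: "c v \<noteq> i" if "v \<in> verts C" for v using that by (auto simp: colour_class_def)
  define k where "k = chromatic_number C - 1"
  have k: "chromatic_number C = Suc k" using i by (simp add: k_def)
  define c' where "c' v = (if c v = k then i else c v)" for v
  have "c v < Suc k" if "v \<in> verts C" for v using c that by (auto simp: proper_colouring_def k)
  then have "c' v < k" if "v \<in> verts C" for v
    using that no[OF that] i k unfolding c'_def by (metis less_Suc_eq)
  moreover have "c' u \<noteq> c' v" if e: "{u, v} \<in> edges C" for u v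
  proof -
    have "c u \<noteq> c v" using c e by (simp add: proper_colouring_def)
    then show ?thesis
      using no[OF edge_verts(1)[OF fin e]] no[OF edge_verts(2)[OF fin e]] by (auto simp: c'_def)
  qed
  ultimately have "proper_colouring C k c'" by (auto simp: proper_colouring_def)
  then show False using chromatic_number_le k by fastforce
qed

lemma proper_colouring_recolour:
  assumes "finite_simple_graph C" and "proper_colouring C s c" and "k < s" and "colour_class C c k = {}"
  shows "proper_colouring C s (c(v := k))"
proof -
  have "c u \<noteq> k" if "u \<in> verts C" for u using assms(4) that by (auto simp: colour_class_def)
  moreover have "c x \<noteq> c y" if "{x, y} \<in> edges C" for x y
    using assms(2) that by (simp add: proper_colouring_def)
  ultimately have "(c(v := k)) x \<noteq> (c(v := k)) y" if "{x, y} \<in> edges C" for x y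
    using that edge_verts[OF assms(1) that] by (metis fun_upd_apply)
  then show ?thesis using assms(2,3) by (auto simp: proper_colouring_def Pi_iff)
qed

lemma colour_class_recolour:
  assumes "v \<in> verts C" and "c v \<noteq> k" and "colour_class C c k = {}"
  shows "colour_class C (c(v := k)) j =
    (if j = k then {v} else if j = c v then colour_class C c (c v) - {v} else colour_class C c j)"
  using assms by (auto simp: colour_class_def)

lemma odd_classes_recolour:
  assumes fin: "finite_simple_graph C" and v: "v \<in> verts C" and k: "k < s" "colour_class C c k = {}"
    and cv: "c v < s"
  shows "odd_classes C s (c(v := k)) = insert k (if c v \<in> odd_classes C s c
    then odd_classes C s c - {c v} else insert (c v) (odd_classes C s c))"
proof -
  have ne: "c v \<noteq> k" using v k by (auto simp: colour_class_def)
  have f: "finite (colour_class C c j)" for j using finite_verts[OF fin] by (simp add: colour_class_def)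
  have mem: "v \<in> colour_class C c (c v)" using v by (simp add: colour_class_def)
  have "card (colour_class C c (c v)) = Suc (card (colour_class C c (c v) - {v}))"
    using card_Suc_Diff1[OF f mem] by simp
  then show ?thesis
    unfolding odd_classes_def colour_class_recolour[OF v ne k(2)] using k cv ne
    by (auto split: if_splits)
qed

lemma odd_classes_subset: "odd_classes C s c \<subseteq> {..<s}"
  by (auto simp: odd_classes_def)

lemma card_odd_classes_le: "card (odd_classes C s c) \<le> s"
  using card_mono[OF _ odd_classes_subset[of C s c]] by simp

lemma colour_class_empty:
  assumes "proper_colouring C k c" and "k \<le> j"
  shows "colour_class C c j = {}"
  using assms by (auto simp: colour_class_def proper_colouring_def Pi_iff not_less[symmetric])

lemma odd_classes_unused:
  assumes "proper_colouring C k c" and "k \<le> s"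
  shows "odd_classes C s c \<subseteq> {..<k}"
proof
  fix i assume "i \<in> odd_classes C s c"
  then have "colour_class C c i \<noteq> {}" by (auto simp: odd_classes_def)
  then show "i \<in> {..<k}" using colour_class_empty[OF assms(1), of i] by (auto simp: not_less[symmetric])
qed

lemma singleton_classes_imp_complete:
  assumes fin: "finite_simple_graph C" and c: "proper_colouring C (chromatic_number C) c"
    and one: "\<And>i. i < chromatic_number C \<Longrightarrow> card (colour_class C c i) = 1"
  shows "graph_isomorphic C (complete_graph (chromatic_number C))"
proof -
  let ?k = "chromatic_number C"
  have ck: "c v < ?k" if "v \<in> verts C" for v using c that by (auto simp: proper_colouring_def)
  have inj: "u = v" if "u \<in> verts C" "v \<in> verts C" "c u = c v" for u v
  proof -
    obtain x where "colour_class C c (c v) = {x}" using one[OF ck[OF \<open>v \<in> verts C\<close>]] by (auto simp: card_1_singleton_iff)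
    moreover have "u \<in> colour_class C c (c v)" "v \<in> colour_class C c (c v)"
      using that by (simp_all add: colour_class_def)
    ultimately show ?thesis by simp
  qed
  have surj: "\<exists>v\<in>verts C. c v = i" if "i < ?k" for i
    using chromatic_colour_class_nonempty[OF fin c that] by (auto simp: colour_class_def)
  have bij: "bij_betw c (verts C) {..<?k}"
    unfolding bij_betw_def inj_on_def using inj surj ck by (auto simp: image_iff) metis
  have adj: "{u, v} \<in> edges C" if uv: "u \<in> verts C" "v \<in> verts C" "u \<noteq> v" for u v
  proof (rule ccontr)
    assume no: "{u, v} \<notin> edges C"
    define c' where "c' = c(u := c v)"
    have "c x \<noteq> c y" if "{x, y} \<in> edges C" for x y using c that by (simp add: proper_colouring_def)
    moreover have "c x \<noteq> c v" if "{x, u} \<in> edges C" for x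
    proof
      assume "c x = c v"
      then have "x = v" using inj edge_verts[OF fin that] uv by blast
      then show False using no that by (simp add: insert_commute)
    qed
    moreover have "c v \<noteq> c x" if "{u, x} \<in> edges C" for x
    proof
      assume "c v = c x"
      then have "x = v" using inj[of x v] edge_verts[OF fin that] uv by simp
      then show False using no that by simp
    qed
    ultimately have "c' x \<noteq> c' y" if "{x, y} \<in> edges C" for x y
      using that edge_verts[OF fin that] by (auto simp: c'_def)
    then have "proper_colouring C ?k c'" using ck uv by (auto simp: proper_colouring_def c'_def)
    moreover have "colour_class C c' (c u) = {}"
      using inj uv by (auto simp: colour_class_def c'_def)
    ultimately show False using chromatic_colour_class_nonempty[OF fin] ck uv by blast
  qed
  have "edges (complete_graph ?k) = (\<lambda>e. c ` e) ` edges C"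
  proof (intro subset_antisym subsetI)
    fix e assume "e \<in> edges (complete_graph ?k)"
    then obtain i j where e: "e = {i, j}" "i \<noteq> j" "i < ?k" "j < ?k"
      by (auto simp: complete_graph_def card_2_iff)
    then obtain u v where "u \<in> verts C" "v \<in> verts C" "c u = i" "c v = j" using surj by metis
    then show "e \<in> (\<lambda>e. c ` e) ` edges C" using e adj by (intro image_eqI[of _ _ "{u, v}"]) auto
  next
    fix e assume "e \<in> (\<lambda>e. c ` e) ` edges C"
    then obtain d where d: "d \<in> edges C" "e = c ` d" by blast
    then obtain u v where uv: "d = {u, v}" using fin by (auto simp: finite_simple_graph_def card_2_iff)
    have "u \<in> verts C" "v \<in> verts C" "c u \<noteq> c v"
      using d uv edge_verts[OF fin, of u v] c by (auto simp: proper_colouring_def)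
    then show "e \<in> edges (complete_graph ?k)" using d uv ck by (auto simp: complete_graph_def)
  qed
  then show ?thesis unfolding graph_isomorphic_def using bij by (auto simp: complete_graph_def)
qed

text \<open>Proper colourings of a complete graph are injective, so all used classes are singletons
  and spare colours cannot change the count. This is why such a graph on \<open>s - 2\<close>
  vertices obstructs although its chromatic number is below \<open>s\<close>.\<close>

lemma complete_odd_classes:
  assumes fin: "finite_simple_graph C" and iso: "graph_isomorphic C (complete_graph n)"
    and c: "proper_colouring C s c"
  shows "card (odd_classes C s c) = n"
proof -
  obtain \<phi> where \<phi>: "bij_betw \<phi> (verts C) {..<n}"
    "{e. e \<subseteq> {..<n} \<and> card e = 2} = (\<lambda>e. \<phi> ` e) ` edges C"
    using iso by (auto simp: graph_isomorphic_def complete_graph_def)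
  have inj: "inj_on \<phi> (verts C)" using \<phi>(1) by (rule bij_betw_imp_inj_on)
  have inj_c: "inj_on c (verts C)"
  proof (rule inj_onI, rule ccontr)
    fix u v assume uv: "u \<in> verts C" "v \<in> verts C" "c u = c v" "u \<noteq> v"
    have "\<phi> u \<noteq> \<phi> v" using inj uv by (auto dest: inj_onD)
    moreover have "\<phi> u < n" "\<phi> v < n" using \<phi>(1) uv by (auto simp: bij_betw_def)
    ultimately have "{\<phi> u, \<phi> v} \<in> (\<lambda>e. \<phi> ` e) ` edges C" unfolding \<phi>(2)[symmetric] by auto
    then obtain e where e: "e \<in> edges C" "\<phi> ` e = \<phi> ` {u, v}" by auto
    have "e \<subseteq> verts C" using e fin by (auto simp: finite_simple_graph_def)
    then have "e = {u, v}" using e(2) inj uv inj_on_image_eq_iff[of \<phi> "verts C" e "{u, v}"] by auto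
    then show False using e c uv by (auto simp: proper_colouring_def)
  qed
  have cls: "colour_class C c (c v) = {v}" if "v \<in> verts C" for v
    using inj_c that by (auto simp: colour_class_def dest: inj_onD)
  have "odd_classes C s c = c ` verts C"
  proof (intro subset_antisym subsetI)
    fix i assume "i \<in> odd_classes C s c"
    then have "colour_class C c i \<noteq> {}" by (auto simp: odd_classes_def)
    then show "i \<in> c ` verts C" by (auto simp: colour_class_def)
  next
    fix i assume "i \<in> c ` verts C"
    then show "i \<in> odd_classes C s c" using c cls by (auto simp: odd_classes_def proper_colouring_def)
  qed
  then show ?thesis using card_image[OF inj_c] bij_betw_same_card[OF \<phi>(1)] by simp
qed

text \<open>Splitting a vertex off a nonempty even class gives two more odd classes.  If all classes are
  odd, splitting two vertices off a class of size at least three into two new classes does so.\<close>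
lemma colouring_avoiding_bad_parity:
  assumes fin: "finite_simple_graph C" and k: "3 \<le> chromatic_number C" "chromatic_number C < s"
    and s: "4 \<le> s" "s \<noteq> 6" and iso: "\<not> graph_isomorphic C (complete_graph (s - 2))"
  shows "\<exists>c. proper_colouring C s c \<and> card (odd_classes C s c) \<noteq> 2 \<and> card (odd_classes C s c) + 2 \<noteq> s"
proof -
  let ?k = "chromatic_number C"
  obtain c where c: "proper_colouring C ?k c"
    using chromatic_number_colouring[OF finite_verts[OF fin]] edge_verts[OF fin] by blast
  have cs: "proper_colouring C s c" using c k(2) by (auto intro: proper_colouring_mono)
  define T where "T = odd_classes C s c"
  have Tk: "T \<subseteq> {..<?k}" unfolding T_def using odd_classes_unused[OF c] k(2) by simp
  have fT: "finite T" using Tk finite_subset by blast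
  have empty: "colour_class C c j = {}" if "?k \<le> j" for j using colour_class_empty[OF c that] .
  have ck: "c v < ?k" if "v \<in> verts C" for v using c that by (auto simp: proper_colouring_def)
  have kT: "j \<notin> T" if "?k \<le> j" for j using Tk that by auto
  show ?thesis
  proof (cases "card T \<noteq> 2 \<and> card T + 2 \<noteq> s")
    case True
    then show ?thesis using cs unfolding T_def by blast
  next
    case bad: False
    show ?thesis
    proof (cases "T = {..<?k}")
      case False
      then obtain i where i: "i < ?k" "i \<notin> T" using Tk by auto
      obtain v where v: "v \<in> verts C" "c v = i"
        using chromatic_colour_class_nonempty[OF fin c i(1)] by (auto simp: colour_class_def)
      have "odd_classes C s (c(v := ?k)) = insert ?k (insert i T)"
        using odd_classes_recolour[OF fin v(1) k(2) empty] v i k(2) by (simp add: T_def)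
      then have "card (odd_classes C s (c(v := ?k))) = card T + 2"
        using i kT[of ?k] fT by simp
      \<comment> \<open>The count 2 becomes 4, and \<open>s - 2\<close> becomes \<open>s\<close>.
        The value 4 would be bad again only for \<open>s = 6\<close>.\<close>
      then show ?thesis
        using bad s proper_colouring_recolour[OF fin cs k(2) empty] by (intro exI[of _ "c(v := ?k)"]) auto
    next
      case True
      \<comment> \<open>Here \<open>card T\<close> is the chromatic number, which is at least 3, so
        the bad count can only be \<open>s - 2\<close>.\<close>
      then have k2: "?k + 2 = s" using bad k by auto
      have "\<exists>i<?k. card (colour_class C c i) \<noteq> 1"
        using singleton_classes_imp_complete[OF fin c] iso k2 by (metis add_diff_cancel_right')
      then obtain i where i: "i < ?k" "card (colour_class C c i) \<noteq> 1" by blast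
      have "odd (card (colour_class C c i))" using i True by (auto simp: T_def odd_classes_def)
      then have c3: "card (colour_class C c i) \<ge> 2" using i by (cases "card (colour_class C c i)") auto
      then obtain U where "U \<subseteq> colour_class C c i" "card U = 2" by (rule obtain_subset_with_card_n)
      then obtain u v where "u \<in> colour_class C c i" "v \<in> colour_class C c i" "u \<noteq> v"
        by (auto simp: card_2_iff)
      then have uv: "u \<in> verts C" "v \<in> verts C" "c u = i" "c v = i" "u \<noteq> v"
        by (auto simp: colour_class_def)
      define c1 where "c1 = c(u := ?k)"
      define c2 where "c2 = c1(v := Suc ?k)"
      have p1: "proper_colouring C s c1"
        unfolding c1_def using proper_colouring_recolour[OF fin cs k(2) empty] by simp
      have o1: "odd_classes C s c1 = insert ?k ({..<?k} - {i})"
        using odd_classes_recolour[OF fin uv(1) k(2) empty] uv i k(2) True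
        by (simp add: T_def[symmetric] c1_def)
      have e1: "colour_class C c1 (Suc ?k) = {}"
        using empty[of "Suc ?k"] by (auto simp: colour_class_def c1_def)
      have s1: "Suc ?k < s" using k2 by simp
      have p2: "proper_colouring C s c2"
        unfolding c2_def using proper_colouring_recolour[OF fin p1 s1 e1] .
      \<comment> \<open>The second removal makes class \<open>i\<close> odd again, so all
        \<open>s\<close> classes are odd.\<close>
      have "odd_classes C s c2 = insert (Suc ?k) (insert i (insert ?k ({..<?k} - {i})))"
        using odd_classes_recolour[OF fin uv(2) s1 e1] uv i k(2) o1
        by (simp add: c2_def) (simp add: c1_def)
      also have "\<dots> = {..<s}" using i(1) k2 by auto
      finally have "card (odd_classes C s c2) = s" by simp
      then show ?thesis using p2 s by (intro exI[of _ c2]) auto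
    qed
  qed
qed

text \<open>The order may exceed the chromatic number of \<open>C\<close>, so one statement covers
  components of smaller chromatic number and also the order \<open>chromatic_number G + 1\<close>.
  The assumptions \<open>mod4\<close> and \<open>pow\<close> concern the case without a spare
  colour; \<open>complete\<close> excludes the graphs that spare colours cannot help.\<close>

lemma (in comm_group) connected_vertex_group_colouring:
  assumes fin: "finite_simple_graph C" and con: "connected_graph C" and card: "card (verts C) \<ge> 3"
    and finG: "finite (carrier G)" and s: "2 \<le> order G" "chromatic_number C \<le> order G"
    and mod4: "order G mod 4 = 2 \<Longrightarrow> chromatic_number C = order G \<Longrightarrow>
      \<exists>c. proper_colouring C (order G) c \<and> card (odd_classes C (order G) c) \<noteq> order G"
    and pow: "\<And>q. q \<ge> 2 \<Longrightarrow> order G = 2 ^ q \<Longrightarrow> chromatic_number C = order G \<Longrightarrow>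
      \<exists>c. proper_colouring C (order G) c \<and> card (odd_classes C (order G) c) \<noteq> 2 \<and>
        card (odd_classes C (order G) c) + 2 \<noteq> order G"
    and complete: "\<And>q. q \<ge> 2 \<Longrightarrow> order G = 2 ^ q \<Longrightarrow> \<not> graph_isomorphic C (complete_graph (order G - 2))"
  shows "\<exists>f. vertex_group_colouring G C f"
proof -
  let ?s = "order G"
  obtain c0 where c0: "proper_colouring C (chromatic_number C) c0"
    using chromatic_number_colouring[OF finite_verts[OF fin]] edge_verts[OF fin] by blast
  have cs0: "proper_colouring C ?s c0" using c0 s(2) by (rule proper_colouring_mono)
  show ?thesis
  proof (cases "chromatic_number C \<le> 2 \<and> ?s \<ge> 3")
    case True
    then show ?thesis
      using bipartite_vertex_group_colouring[OF fin con card] proper_colouring_mono[OF c0] by blast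
  next
    case False
    obtain r where r: "r \<in> verts C" using con by (auto simp: connected_graph_def)
    \<comment> \<open>In a group of order two every element is its own inverse. For any other order
      the chromatic number exceeds two in this case, which gives an odd closed walk.\<close>
    have odd: "parity_walk C True r r \<or> involutions = carrier G"
    proof (cases "?s = 2")
      case True
      have "x \<otimes> x = \<one>" if x: "x \<in> carrier G" for x
      proof (cases "x = \<one>")
        case False
        have "{\<one>, x} = carrier G" using False x True finG by (intro card_subset_eq) (auto simp: order_def)
        then have "x \<otimes> x = \<one> \<or> x \<otimes> x = x" using x m_closed[of x x] by blast
        then show ?thesis using False x by auto
      qed simp
      then show ?thesis by (auto simp: involutions_def)
    next
      case ne: False
      then have "\<not> (\<exists>c. proper_colouring C 2 c)" using False s chromatic_number_le[of C 2] by fastforce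
      then show ?thesis using odd_closed_walk[OF fin con r] by blast
    qed
    have "\<exists>c. proper_colouring C ?s c \<and> (?s mod 4 = 2 \<longrightarrow> card (odd_classes C ?s c) \<noteq> ?s) \<and>
      (\<forall>q\<ge>2. ?s = 2 ^ q \<longrightarrow> card (odd_classes C ?s c) \<noteq> 2 \<and> card (odd_classes C ?s c) + 2 \<noteq> ?s)"
    proof (cases "\<exists>q\<ge>2. ?s = 2 ^ q")
      case True
      then obtain q where q: "q \<ge> 2" "?s = 2 ^ q" by blast
      obtain p where "q = p + 2" using q(1) by (metis add.commute le_Suc_ex)
      then have s4: "?s = 4 * 2 ^ p" using q by simp
      have "?s \<noteq> 6"
      proof
        assume "?s = 6"
        then have "4 * 2 ^ p = (6::nat)" using s4 by simp
        then show False by presburger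
      qed
      moreover have "?s \<ge> 4" "?s mod 4 \<noteq> 2" using s4 by simp_all
      ultimately have "\<exists>c. proper_colouring C ?s c \<and> card (odd_classes C ?s c) \<noteq> 2 \<and> card (odd_classes C ?s c) + 2 \<noteq> ?s"
        using pow[OF q] colouring_avoiding_bad_parity[OF fin _ _ _ _ complete[OF q]] False s
        by (cases "chromatic_number C = ?s") auto
      then show ?thesis using \<open>?s mod 4 \<noteq> 2\<close> by blast
    next
      case np: False
      show ?thesis
      proof (cases "chromatic_number C = ?s")
        case True
        then show ?thesis using mod4 np cs0 by blast
      next
        case False
        \<comment> \<open>A spare colour has an empty, hence even, class, so not all
          \<open>?s\<close> classes are odd.\<close>
        have "card (odd_classes C ?s c0) \<le> card {..<chromatic_number C}"
          using odd_classes_unused[OF c0 s(2)] by (intro card_mono) auto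
        then have "card (odd_classes C ?s c0) \<noteq> ?s" using False s by simp
        then show ?thesis using np cs0 by blast
      qed
    qed
    then obtain c where c: "proper_colouring C ?s c" "?s mod 4 = 2 \<Longrightarrow> card (odd_classes C ?s c) \<noteq> ?s"
      "\<And>q. q \<ge> 2 \<Longrightarrow> ?s = 2 ^ q \<Longrightarrow> card (odd_classes C ?s c) \<noteq> 2 \<and> card (odd_classes C ?s c) + 2 \<noteq> ?s"
      by blast
    have "\<exists>T\<subseteq>carrier G. card T = card (odd_classes C ?s c) \<and> (\<exists>g\<in>carrier G. set_prod T = g \<otimes> g)"
      by (rule subset_prod_square[OF finG card_odd_classes_le]; fact c)
    then obtain T g where "T \<subseteq> carrier G" "card T = card (odd_classes C ?s c)" "g \<in> carrier G" "set_prod T = g \<otimes> g"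
      by blast
    then show ?thesis using odd_classes_imp_vertex_group_colouring[OF fin con r odd finG c(1)] by blast
  qed
qed

section \<open>Components and the theorem\<close>

definition component :: "'a sgraph \<Rightarrow> 'a \<Rightarrow> 'a sgraph" where
  "component G v = induced_subgraph G {u \<in> verts G. (v, u) \<in> (adj G)\<^sup>*}"

lemma graph_components_eq: "graph_components G = component G ` verts G"
  by (auto simp: graph_components_def component_def)

lemma verts_component: "verts (component G v) = {u \<in> verts G. (v, u) \<in> (adj G)\<^sup>*}"
  by (simp add: component_def induced_subgraph_def)

lemma edges_component: "edges (component G v) = {e \<in> edges G. e \<subseteq> verts (component G v)}"
  by (simp add: component_def induced_subgraph_def)

lemma adj_rtrancl_sym: "(u, v) \<in> (adj G)\<^sup>* \<Longrightarrow> (v, u) \<in> (adj G)\<^sup>*"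
proof -
  have "sym (adj G)" by (auto simp: sym_def adj_def insert_commute)
  then show "(u, v) \<in> (adj G)\<^sup>* \<Longrightarrow> (v, u) \<in> (adj G)\<^sup>*" by (meson sym_rtrancl symD)
qed

lemma component_cong:
  assumes "u \<in> verts (component G v)"
  shows "component G u = component G v"
proof -
  have uv: "(v, u) \<in> (adj G)\<^sup>*" using assms by (simp add: verts_component)
  have "(u, x) \<in> (adj G)\<^sup>* \<longleftrightarrow> (v, x) \<in> (adj G)\<^sup>*" for x
    using uv adj_rtrancl_sym by (meson rtrancl_trans)
  then show ?thesis by (simp add: component_def)
qed

lemma finite_simple_graph_component:
  assumes "finite_simple_graph G"
  shows "finite_simple_graph (component G v)"
  using assms unfolding finite_simple_graph_def edges_component by (auto simp: verts_component)

lemma connected_component: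
  assumes G: "finite_simple_graph G" and v: "v \<in> verts G"
  shows "connected_graph (component G v)"
proof -
  let ?C = "component G v"
  have reach: "(v, u) \<in> (adj ?C)\<^sup>*" if "(v, u) \<in> (adj G)\<^sup>*" for u
    using that
  proof induction
    case (step x y)
    have e: "{x, y} \<in> edges G" using step.hyps(2) by (simp add: adj_def)
    have "(v, y) \<in> (adj G)\<^sup>*" using step.hyps by (rule rtrancl_into_rtrancl)
    then have "{x, y} \<in> edges ?C"
      using e step.hyps(1) edge_verts[OF G e] by (simp add: edges_component verts_component)
    then show ?case using step.IH by (auto simp: adj_def intro: rtrancl_into_rtrancl)
  qed simp
  have "(x, y) \<in> (adj ?C)\<^sup>*" if "x \<in> verts ?C" "y \<in> verts ?C" for x y
    using that reach adj_rtrancl_sym[of v x ?C] by (auto simp: verts_component intro: rtrancl_trans)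
  moreover have "v \<in> verts ?C" using v by (simp add: verts_component)
  ultimately show ?thesis by (auto simp: connected_graph_def)
qed

lemma edges_at_component:
  assumes G: "finite_simple_graph G" and u: "u \<in> verts (component G v)"
  shows "{e \<in> edges (component G v). u \<in> e} = {e \<in> edges G. u \<in> e}"
proof -
  have "e \<subseteq> verts (component G v)" if e: "e \<in> edges G" "u \<in> e" for e
  proof
    fix x assume x: "x \<in> e"
    have sub: "e \<subseteq> verts G" "card e = 2" using G e by (auto simp: finite_simple_graph_def)
    have "(u, x) \<in> (adj G)\<^sup>*"
    proof (cases "x = u")
      case False
      then have "e = {u, x}" using sub(2) e(2) x by (auto simp: card_2_iff)
      then show ?thesis using e by (auto simp: adj_def)
    qed simp
    then show "x \<in> verts (component G v)"
      using u x sub by (auto simp: verts_component intro: rtrancl_trans)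
  qed
  then show ?thesis by (auto simp: edges_component)
qed

lemma chromatic_number_component_le:
  assumes "finite_simple_graph G"
  shows "chromatic_number (component G v) \<le> chromatic_number G"
proof -
  obtain c where "proper_colouring G (chromatic_number G) c"
    using chromatic_number_colouring[OF finite_verts[OF assms]] edge_verts[OF assms] by blast
  then have "proper_colouring (component G v) (chromatic_number G) c"
    by (auto simp: proper_colouring_def edges_component verts_component)
  then show ?thesis by (rule chromatic_number_le)
qed

lemma vertex_group_colouring_component:
  assumes G: "finite_simple_graph G" and f: "vertex_group_colouring \<G> G f"
  shows "vertex_group_colouring \<G> (component G v) f"
proof -
  have wd: "weighted_degree \<G> (component G v) f u = weighted_degree \<G> G f u"
    if "u \<in> verts (component G v)" for u
    using edges_at_component[OF G that] by (simp add: weighted_degree_def)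
  have "weighted_degree \<G> (component G v) f u \<noteq> weighted_degree \<G> (component G v) f w"
    if "{u, w} \<in> edges (component G v)" for u w
  proof -
    have "{u, w} \<in> edges G" "u \<in> verts (component G v)" "w \<in> verts (component G v)"
      using that by (auto simp: edges_component)
    then show ?thesis using f wd by (simp add: vertex_group_colouring_def)
  qed
  moreover have "f \<in> edges (component G v) \<rightarrow> carrier \<G>"
    using f by (auto simp: vertex_group_colouring_def edges_component)
  ultimately show ?thesis by (simp add: vertex_group_colouring_def)
qed

text \<open>\<open>F\<close> depends on the component as a graph and not on a vertex of it, so a
  component uses one labelling throughout. The ends of an edge lie in one component, which makes the
  choice of an end in \<open>f\<close> harmless.\<close>

lemma (in comm_group) vertex_group_colouring_components:
  assumes \<Gamma>: "finite_simple_graph \<Gamma>"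
    and C: "\<And>v. v \<in> verts \<Gamma> \<Longrightarrow> \<exists>f. vertex_group_colouring G (component \<Gamma> v) f"
  shows "\<exists>f. vertex_group_colouring G \<Gamma> f"
proof -
  define F where "F C = (SOME f. vertex_group_colouring G C f)" for C :: "'c sgraph"
  have F: "vertex_group_colouring G (component \<Gamma> v) (F (component \<Gamma> v))" if "v \<in> verts \<Gamma>" for v
    unfolding F_def using C[OF that] by (rule someI_ex)
  define f where "f e = F (component \<Gamma> (SOME v. v \<in> e)) e" for e
  have self: "v \<in> verts (component \<Gamma> v)" if "v \<in> verts \<Gamma>" for v using that by (simp add: verts_component)
  have in_comp: "e \<in> edges (component \<Gamma> v)" if "e \<in> edges \<Gamma>" "v \<in> e" "v \<in> verts \<Gamma>" for e v
    using edges_at_component[OF \<Gamma> self[OF that(3)]] that by blast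
  have f: "f e = F (component \<Gamma> v) e" if e: "e \<in> edges \<Gamma>" "v \<in> e" "v \<in> verts \<Gamma>" for e v
  proof -
    have "(SOME v. v \<in> e) \<in> e" using e(2) by (rule someI)
    then have "(SOME v. v \<in> e) \<in> verts (component \<Gamma> v)"
      using in_comp[OF e] by (auto simp: edges_component)
    then show ?thesis unfolding f_def using component_cong by metis
  qed
  have wd: "weighted_degree G \<Gamma> f v = weighted_degree G (component \<Gamma> v) (F (component \<Gamma> v)) v"
    if v: "v \<in> verts \<Gamma>" for v
  proof -
    have "finprod G f {e \<in> edges \<Gamma>. v \<in> e} = finprod G (F (component \<Gamma> v)) {e \<in> edges \<Gamma>. v \<in> e}"
    proof (rule finprod_cong')
      show "F (component \<Gamma> v) \<in> {e \<in> edges \<Gamma>. v \<in> e} \<rightarrow> carrier G"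
        using F[OF v] in_comp[OF _ _ v] by (auto simp: vertex_group_colouring_def Pi_iff)
    qed (use f v in auto)
    then show ?thesis unfolding weighted_degree_def edges_at_component[OF \<Gamma> self[OF v]] .
  qed
  have "f e \<in> carrier G" if e: "e \<in> edges \<Gamma>" for e
  proof -
    have "e \<subseteq> verts \<Gamma>" "card e = 2" using e \<Gamma> by (auto simp: finite_simple_graph_def)
    then obtain v where v: "v \<in> e" "v \<in> verts \<Gamma>" by (auto simp: card_2_iff)
    then show ?thesis
      using f[OF e v] F[OF v(2)] in_comp[OF e v] by (auto simp: vertex_group_colouring_def Pi_iff)
  qed
  moreover have "weighted_degree G \<Gamma> f u \<noteq> weighted_degree G \<Gamma> f v" if e: "{u, v} \<in> edges \<Gamma>" for u v
  proof -
    have uv: "u \<in> verts \<Gamma>" "v \<in> verts \<Gamma>" using edge_verts[OF \<Gamma> e] by auto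
    have e': "{u, v} \<in> edges (component \<Gamma> u)" using in_comp[OF e _ uv(1)] by simp
    then have "v \<in> verts (component \<Gamma> u)" by (auto simp: edges_component)
    then have "component \<Gamma> v = component \<Gamma> u" by (rule component_cong)
    then show ?thesis using wd uv F[OF uv(1)] e' by (simp add: vertex_group_colouring_def)
  qed
  ultimately have "vertex_group_colouring G \<Gamma> f" by (auto simp: vertex_group_colouring_def)
  then show ?thesis by blast
qed

section \<open>The obstructing groups: cyclic and elementary abelian\<close>

lemma order_integer_mod_group: "0 < n \<Longrightarrow> order (integer_mod_group n) = n"
  by (simp add: order_def carrier_integer_mod_group)

lemma even_mod_even: "even (n::int) \<Longrightarrow> even (x mod n) \<longleftrightarrow> even x"
  by (metis dvd_mod_iff)

text \<open>Reduction modulo an even \<open>n\<close> preserves parity, so the parity of the group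
  product can be read off the ordinary integer sum.\<close>

lemma finprod_integer_mod_group_parity:
  assumes "0 < n" "even n" "finite A" "A \<subseteq> carrier (integer_mod_group n)"
  shows "even (finprod (integer_mod_group n) (\<lambda>x. x) A) \<longleftrightarrow> even (\<Sum>A)"
  using assms(3,4)
proof induction
  case empty
  interpret comm_group "integer_mod_group n" by (rule abelian_integer_mod_group)
  show ?case by simp
next
  case (insert x A)
  interpret comm_group "integer_mod_group n" by (rule abelian_integer_mod_group)
  have "finprod (integer_mod_group n) (\<lambda>x. x) (insert x A) =
      (x + finprod (integer_mod_group n) (\<lambda>x. x) A) mod int n"
    using insert assms(1) by (subst finprod_insert) (auto simp: integer_mod_group_def)
  then show ?case using insert assms(2) by (simp add: even_mod_even)
qed

text \<open>Starting from \<open>0 + 1\<close>, each step of the induction adds four consecutive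
  integers, whose sum is even.\<close>

lemma odd_sum_residues: "odd (\<Sum>{0..<int (4 * k + 2)})"
proof (induction k)
  case 0
  have "{0..<2::int} = {0, 1}" by auto
  then show ?case by simp
next
  case (Suc k)
  define m where "m = int (4 * k + 2)"
  have "{0..<int (4 * Suc k + 2)} = {0..<m} \<union> {m, m + 1, m + 2, m + 3}" by (auto simp: m_def)
  moreover have "{0..<m} \<inter> {m, m + 1, m + 2, m + 3} = {}" by auto
  ultimately have "\<Sum>{0..<int (4 * Suc k + 2)} = \<Sum>{0..<m} + \<Sum>{m, m + 1, m + 2, m + 3}"
    by (simp add: sum.union_disjoint)
  then show ?case using Suc by (simp add: m_def)
qed

text \<open>Parity is well defined modulo an even number; doubles are even, whereas the sum of all
  residues is odd.\<close>

lemma integer_mod_group_carrier_prod_not_square: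
  assumes "n = 4 * k + 2" and "g \<in> carrier (integer_mod_group n)"
  shows "finprod (integer_mod_group n) (\<lambda>x. x) (carrier (integer_mod_group n)) \<noteq> g \<otimes>\<^bsub>integer_mod_group n\<^esub> g"
proof -
  have n: "0 < n" "even n" using assms(1) by auto
  have c: "carrier (integer_mod_group n) = {0..<int n}" using n by (simp add: carrier_integer_mod_group)
  have "odd (finprod (integer_mod_group n) (\<lambda>x. x) (carrier (integer_mod_group n)))"
  proof -
    have "finite (carrier (integer_mod_group n))" by (simp add: c)
    moreover have "odd (\<Sum>(carrier (integer_mod_group n)))"
      unfolding c unfolding assms(1) by (rule odd_sum_residues)
    ultimately show ?thesis using finprod_integer_mod_group_parity[OF n] by blast
  qed
  moreover have "g \<otimes>\<^bsub>integer_mod_group n\<^esub> g = (g + g) mod int n" using n by (simp add: integer_mod_group_def)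
  then have "even (g \<otimes>\<^bsub>integer_mod_group n\<^esub> g)" using n by (simp add: even_mod_even)
  ultimately show ?thesis by metis
qed

text \<open>A model of the elementary abelian 2-group of rank \<open>q\<close>: symmetric difference
  makes each set its own inverse.\<close>

definition sym_diff_group :: "nat \<Rightarrow> nat set monoid" where
  "sym_diff_group q = \<lparr>carrier = Pow {..<q}, monoid.mult = (\<lambda>A B. (A - B) \<union> (B - A)), one = {}\<rparr>"

lemma comm_group_sym_diff_group: "comm_group (sym_diff_group q)"
proof (rule comm_groupI)
  fix x assume "x \<in> carrier (sym_diff_group q)"
  then show "\<exists>y\<in>carrier (sym_diff_group q). y \<otimes>\<^bsub>sym_diff_group q\<^esub> x = \<one>\<^bsub>sym_diff_group q\<^esub>"
    by (intro bexI[of _ x]) (auto simp: sym_diff_group_def)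
qed (auto simp: sym_diff_group_def)

lemma order_sym_diff_group: "order (sym_diff_group q) = 2 ^ q"
  by (simp add: order_def sym_diff_group_def card_Pow)

lemma sym_diff_group_subset_prod_not_square:
  assumes "q \<ge> 2" and T: "T \<subseteq> carrier (sym_diff_group q)" "card T = 2 \<or> card T + 2 = 2 ^ q"
    and g: "g \<in> carrier (sym_diff_group q)"
  shows "finprod (sym_diff_group q) (\<lambda>x. x) T \<noteq> g \<otimes>\<^bsub>sym_diff_group q\<^esub> g"
proof -
  interpret comm_group "sym_diff_group q" by (rule comm_group_sym_diff_group)
  have inv: "involutions = carrier (sym_diff_group q)" unfolding involutions_def by (auto simp: sym_diff_group_def)
  have fin: "finite (carrier (sym_diff_group q))" by (simp add: sym_diff_group_def)
  have "order (sym_diff_group q) \<ge> 4"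
    unfolding order_sym_diff_group using power_increasing[OF assms(1), of "2::nat"] by simp
  then have "finprod (sym_diff_group q) (\<lambda>x. x) T \<noteq> \<one>\<^bsub>sym_diff_group q\<^esub>"
    using elementary_subset_prod_neq_one[OF fin inv _ T(1)] T(2) by (simp add: order_sym_diff_group)
  moreover have "g \<otimes>\<^bsub>sym_diff_group q\<^esub> g = \<one>\<^bsub>sym_diff_group q\<^esub>" by (simp add: sym_diff_group_def)
  ultimately show ?thesis by simp
qed

text \<open>The necessary condition for one component and an arbitrary test group. The type of
  \<open>\<G>\<close> is left free because the test groups consist of integers and of sets, not of
  natural numbers.\<close>

lemma group_sum_colourable_odd_classes:
  fixes \<G> :: "('b, 'm) monoid_scheme"
  assumes G: "finite_simple_graph G" and col: "group_sum_colourable G s" and s: "0 < s"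
    and \<G>: "comm_group \<G>" "order \<G> = s"
  shows "\<exists>c T. proper_colouring (component G v) s c \<and> T \<subseteq> carrier \<G> \<and>
    card T = card (odd_classes (component G v) s c) \<and> (\<exists>g\<in>carrier \<G>. finprod \<G> (\<lambda>x. x) T = g \<otimes>\<^bsub>\<G>\<^esub> g)"
proof -
  interpret comm_group \<G> by fact
  have fin: "finite (carrier \<G>)" using \<G>(2) s card_ge_0_finite unfolding order_def by blast
  obtain f where "vertex_group_colouring \<G> G f"
    using group_sum_colourable_any_type[OF \<G> s col] by blast
  then have "vertex_group_colouring \<G> (component G v) f" by (rule vertex_group_colouring_component[OF G])
  from vertex_group_colouring_imp_odd_classes[OF finite_simple_graph_component[OF G] fin this]
  show ?thesis unfolding \<G>(2) .
qed

text \<open>Weighted degrees in a group of order \<open>s\<close> are a proper colouring with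
  \<open>s\<close> colours; the cyclic group provides such a group for every positive
  \<open>s\<close>.\<close>

lemma chromatic_number_le_group_sum:
  assumes G: "finite_simple_graph G" and col: "group_sum_colourable G s" and s: "0 < s"
  shows "chromatic_number G \<le> s"
proof -
  let ?Z = "integer_mod_group s"
  interpret comm_group ?Z by (rule abelian_integer_mod_group)
  have ord: "order ?Z = s" using s by (rule order_integer_mod_group)
  have fin: "finite (carrier ?Z)" using s by (simp add: carrier_integer_mod_group)
  obtain f where "vertex_group_colouring ?Z G f"
    using group_sum_colourable_any_type[OF comm_group_axioms ord s col] by blast
  from vertex_group_colouring_imp_odd_classes[OF G fin this]
  show ?thesis using chromatic_number_le unfolding ord by blast
qed

lemma two_le_chromatic_number:
  assumes G: "finite_simple_graph G" and v: "v \<in> verts G" and card: "card (verts (component G v)) \<ge> 3"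
  shows "2 \<le> chromatic_number G"
proof -
  have "\<not> verts (component G v) \<subseteq> {v}" using card card_mono[of "{v}" "verts (component G v)"] by auto
  then obtain u where u: "(v, u) \<in> (adj G)\<^sup>*" "u \<noteq> v" by (auto simp: verts_component)
  then obtain x where "(v, x) \<in> adj G" by (metis converse_rtranclE)
  then have e: "{v, x} \<in> edges G" by (simp add: adj_def)
  obtain c where "proper_colouring G (chromatic_number G) c"
    using chromatic_number_colouring[OF finite_verts[OF G]] edge_verts[OF G] by blast
  then have "c v < chromatic_number G" "c x < chromatic_number G" "c v \<noteq> c x"
    using edge_verts[OF G e] e by (auto simp: proper_colouring_def)
  then show ?thesis by linarith
qed

section \<open>Orders that admit labellings of the whole graph, and orders that do not\<close>

lemma four_dvd_power_of_2: "q \<ge> 2 \<Longrightarrow> (4::nat) dvd 2 ^ q"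
  using le_imp_power_dvd[of 2 q "2::nat"] by simp

text \<open>The order is odd, hence neither 2 modulo 4 nor a power \<open>2 ^ q\<close> with
  \<open>q \<ge> 2\<close>, so the three exceptional conditions for connected graphs hold
  vacuously.\<close>

lemma group_sum_colourable_Suc_chromatic_number:
  assumes G: "finite_simple_graph G" and comp: "\<forall>C\<in>graph_components G. card (verts C) \<ge> 3"
    and two: "2 \<le> chromatic_number G" and ev: "even (chromatic_number G)"
  shows "group_sum_colourable G (chromatic_number G + 1)"
  unfolding group_sum_colourable_def
proof (intro allI impI, elim conjE)
  fix \<G> :: "nat monoid"
  assume \<G>: "comm_group \<G>" "order \<G> = chromatic_number G + 1"
  interpret comm_group \<G> by fact
  have fin: "finite (carrier \<G>)" using \<G>(2) card_ge_0_finite[of "carrier \<G>"] by (simp add: order_def)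
  show "\<exists>f. vertex_group_colouring \<G> G f"
  proof (rule vertex_group_colouring_components[OF G])
    fix v assume v: "v \<in> verts G"
    show "\<exists>f. vertex_group_colouring \<G> (component G v) f"
    proof (rule connected_vertex_group_colouring)
      show "card (verts (component G v)) \<ge> 3" using comp v by (simp add: graph_components_eq)
      show "chromatic_number (component G v) \<le> order \<G>"
        using chromatic_number_component_le[OF G, of v] \<G>(2) by simp
      have "odd (order \<G>)" using ev \<G>(2) by simp
      then have "order \<G> mod 4 \<noteq> 2" and "q \<ge> 2 \<Longrightarrow> order \<G> \<noteq> 2 ^ q" for q :: nat
        by (presburger, auto)
      then show "order \<G> mod 4 = 2 \<Longrightarrow> chromatic_number (component G v) = order \<G> \<Longrightarrow>
          \<exists>c. proper_colouring (component G v) (order \<G>) c \<and> card (odd_classes (component G v) (order \<G>) c) \<noteq> order \<G>"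
        and "q \<ge> 2 \<Longrightarrow> order \<G> = 2 ^ q \<Longrightarrow> chromatic_number (component G v) = order \<G> \<Longrightarrow>
          \<exists>c. proper_colouring (component G v) (order \<G>) c \<and> card (odd_classes (component G v) (order \<G>) c) \<noteq> 2 \<and>
          card (odd_classes (component G v) (order \<G>) c) + 2 \<noteq> order \<G>"
        and "q \<ge> 2 \<Longrightarrow> order \<G> = 2 ^ q \<Longrightarrow> \<not> graph_isomorphic (component G v) (complete_graph (order \<G> - 2))"
        for q :: nat
        by auto
    qed (use finite_simple_graph_component[OF G] connected_component[OF G v] fin two \<G>(2) in auto)
  qed
qed

text \<open>A component that attains the chromatic number is not ugly, and the negation of ugliness
  yields exactly the colouring with an admissible number of odd classes.\<close>

lemma group_sum_colourable_chromatic_number: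
  assumes G: "finite_simple_graph G" and comp: "\<forall>C\<in>graph_components G. card (verts C) \<ge> 3"
    and two: "2 \<le> chromatic_number G"
    and ugly: "\<not> (\<exists>C\<in>graph_components G. ugly C \<and> chromatic_number C = chromatic_number G)"
    and complete: "(\<exists>q\<ge>2. chromatic_number G = 2 ^ q) \<longrightarrow>
      \<not> (\<exists>C\<in>graph_components G. graph_isomorphic C (complete_graph (chromatic_number G - 2)))"
  shows "group_sum_colourable G (chromatic_number G)"
  unfolding group_sum_colourable_def
proof (intro allI impI, elim conjE)
  let ?s = "chromatic_number G"
  fix \<G> :: "nat monoid"
  assume \<G>: "comm_group \<G>" "order \<G> = ?s"
  interpret comm_group \<G> by fact
  have fin: "finite (carrier \<G>)" using \<G>(2) two card_ge_0_finite[of "carrier \<G>"] by (simp add: order_def)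
  show "\<exists>f. vertex_group_colouring \<G> G f"
  proof (rule vertex_group_colouring_components[OF G])
    fix v assume v: "v \<in> verts G"
    let ?C = "component G v"
    have C: "?C \<in> graph_components G" using v by (simp add: graph_components_eq)
    have card: "card (verts ?C) \<ge> 3" using comp C by blast
    have con: "connected_graph ?C" using connected_component[OF G v] .
    show "\<exists>f. vertex_group_colouring \<G> ?C f"
    proof (rule connected_vertex_group_colouring)
      assume mod4: "order \<G> mod 4 = 2" and chi: "chromatic_number ?C = order \<G>"
      have "\<exists>k. chromatic_number ?C = 4 * k + 2" using mod4 chi by (metis mult_div_mod_eq)
      moreover have "\<not> ugly ?C" using ugly C chi \<G>(2) by auto
      ultimately obtain c i where c: "proper_colouring ?C ?s c" "i < ?s" "even (card (colour_class ?C c i))"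
        unfolding ugly_def using con card chi \<G>(2) by auto
      then have "odd_classes ?C ?s c \<subseteq> {..<?s} - {i}" by (auto simp: odd_classes_def)
      then have "card (odd_classes ?C ?s c) \<le> card ({..<?s} - {i})" by (intro card_mono) auto
      also have "\<dots> < ?s" using c(2) by simp
      finally show "\<exists>c. proper_colouring ?C (order \<G>) c \<and> card (odd_classes ?C (order \<G>) c) \<noteq> order \<G>"
        using c \<G>(2) by auto
    next
      fix q :: nat assume q: "q \<ge> 2" "order \<G> = 2 ^ q" and chi: "chromatic_number ?C = order \<G>"
      have "\<not> ugly ?C" using ugly C chi \<G>(2) by auto
      moreover have "chromatic_number ?C = 2 ^ q" using chi q by simp
      ultimately have "\<exists>c. proper_colouring ?C (chromatic_number ?C) c \<and>
          card (odd_classes ?C (chromatic_number ?C) c) \<noteq> 2 \<and>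
          card (odd_classes ?C (chromatic_number ?C) c) \<noteq> 2 ^ q - 2"
        using con card q(1) unfolding ugly_def by blast
      then obtain c where "proper_colouring ?C ?s c" "card (odd_classes ?C ?s c) \<noteq> 2"
          "card (odd_classes ?C ?s c) \<noteq> 2 ^ q - 2"
        unfolding chi \<G>(2) by blast
      then show "\<exists>c. proper_colouring ?C (order \<G>) c \<and> card (odd_classes ?C (order \<G>) c) \<noteq> 2 \<and>
          card (odd_classes ?C (order \<G>) c) + 2 \<noteq> order \<G>"
        using q \<G>(2) by (intro exI[of _ c]) auto
    next
      fix q :: nat assume q: "q \<ge> 2" "order \<G> = 2 ^ q"
      then show "\<not> graph_isomorphic ?C (complete_graph (order \<G> - 2))"
        using complete C \<G>(2) by auto
    qed (use finite_simple_graph_component[OF G] con card fin two \<G>(2) chromatic_number_component_le[OF G] in auto)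
  qed
qed

text \<open>One test group per kind of ugliness. If all classes are odd, the set \<open>T\<close> is
  the whole cyclic group; in the other kind \<open>T\<close> is a pair, or the complement of a pair,
  in the elementary 2-group.\<close>

lemma not_group_sum_colourable_ugly:
  assumes G: "finite_simple_graph G" and v: "v \<in> verts G"
    and ugly: "ugly (component G v)" "chromatic_number (component G v) = s"
  shows "\<not> group_sum_colourable G s"
proof
  assume col: "group_sum_colourable G s"
  let ?C = "component G v"
  consider (four) k where "s = 4 * k + 2" "\<And>c. proper_colouring ?C s c \<Longrightarrow> \<forall>i<s. odd (card (colour_class ?C c i))"
    | (pow) q where "q \<ge> 2" "s = 2 ^ q" "\<And>c. proper_colouring ?C s c \<Longrightarrow>
        card (odd_classes ?C s c) = 2 \<or> card (odd_classes ?C s c) = 2 ^ q - 2"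
    using ugly unfolding ugly_def by blast
  then show False
  proof cases
    case four
    let ?Z = "integer_mod_group s"
    have s: "0 < s" using four(1) by simp
    obtain c T g where c: "proper_colouring ?C s c" and T: "T \<subseteq> carrier ?Z" "card T = card (odd_classes ?C s c)"
      and g: "g \<in> carrier ?Z" "finprod ?Z (\<lambda>x. x) T = g \<otimes>\<^bsub>?Z\<^esub> g"
      using group_sum_colourable_odd_classes[OF G col s abelian_integer_mod_group order_integer_mod_group[OF s]]
      by blast
    have "odd_classes ?C s c = {..<s}" using four(2)[OF c] by (auto simp: odd_classes_def)
    then have "card T = card (carrier ?Z)" using T(2) s by (simp add: carrier_integer_mod_group)
    then have "T = carrier ?Z" using T(1) s by (intro card_subset_eq) (auto simp: carrier_integer_mod_group)
    then show False using integer_mod_group_carrier_prod_not_square[OF four(1) g(1)] g(2) by simp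
  next
    case pow
    have s: "0 < s" using pow(2) by simp
    \<comment> \<open>This lets the truncated difference \<open>2 ^ q - 2\<close> be rewritten as
      \<open>card T + 2 = 2 ^ q\<close>.\<close>
    have "4 \<le> s" using four_dvd_power_of_2[OF pow(1)] s pow(2) by (simp add: dvd_imp_le)
    moreover obtain c T g where c: "proper_colouring ?C s c" and T: "T \<subseteq> carrier (sym_diff_group q)"
        "card T = card (odd_classes ?C s c)"
      and g: "g \<in> carrier (sym_diff_group q)" "finprod (sym_diff_group q) (\<lambda>x. x) T = g \<otimes>\<^bsub>sym_diff_group q\<^esub> g"
      using group_sum_colourable_odd_classes[OF G col s comm_group_sym_diff_group] order_sym_diff_group pow(2)
      by metis
    ultimately have "card T = 2 \<or> card T + 2 = 2 ^ q" using pow(2) pow(3)[OF c] by auto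
    then show False using sym_diff_group_subset_prod_not_square[OF pow(1) T(1) _ g(1)] g(2) by simp
  qed
qed

text \<open>Every proper colouring of this component has \<open>s - 2\<close> odd classes, a size
  whose product is never a square in the elementary 2-group.\<close>

lemma not_group_sum_colourable_complete:
  assumes G: "finite_simple_graph G" and v: "v \<in> verts G" and q: "q \<ge> 2" "s = 2 ^ q"
    and iso: "graph_isomorphic (component G v) (complete_graph (s - 2))"
  shows "\<not> group_sum_colourable G s"
proof
  assume col: "group_sum_colourable G s"
  have s: "0 < s" using q by simp
  have "4 \<le> s" using four_dvd_power_of_2[OF q(1)] s q(2) by (simp add: dvd_imp_le)
  moreover obtain c T g where c: "proper_colouring (component G v) s c" and T: "T \<subseteq> carrier (sym_diff_group q)"
      "card T = card (odd_classes (component G v) s c)"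
    and g: "g \<in> carrier (sym_diff_group q)" "finprod (sym_diff_group q) (\<lambda>x. x) T = g \<otimes>\<^bsub>sym_diff_group q\<^esub> g"
    using group_sum_colourable_odd_classes[OF G col s comm_group_sym_diff_group] order_sym_diff_group q(2)
    by metis
  ultimately have "card T + 2 = 2 ^ q"
    using complete_odd_classes[OF finite_simple_graph_component[OF G] iso c] q(2) by simp
  then show False using sym_diff_group_subset_prod_not_square[OF q(1) T(1) _ g(1)] g(2) by simp
qed

theorem theorem1p2:
  fixes G :: "'a sgraph"
  assumes "finite_simple_graph G" and "verts G \<noteq> {}"
    and "\<forall>C\<in>graph_components G. card (verts C) \<ge> 3"
  shows "group_sum_chromatic_number G =
    (if \<not> (\<exists>C\<^sub>1\<in>graph_components G. ugly C\<^sub>1 \<and> chromatic_number C\<^sub>1 = chromatic_number G) \<and>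
        ((\<exists>q\<ge>2. chromatic_number G = 2 ^ q) \<longrightarrow>
           \<not> (\<exists>C\<^sub>2\<in>graph_components G.
                 graph_isomorphic C\<^sub>2 (complete_graph (chromatic_number G - 2))))
     then chromatic_number G
     else chromatic_number G + 1)"
proof -
  let ?s = "chromatic_number G"
  obtain v where v: "v \<in> verts G" using assms(2) by blast
  have two: "2 \<le> ?s"
    using two_le_chromatic_number[OF assms(1) v] assms(3) v by (simp add: graph_components_eq)
  have least: "group_sum_chromatic_number G = s"
    if "0 < s" "group_sum_colourable G s" "\<And>t. 0 < t \<Longrightarrow> group_sum_colourable G t \<Longrightarrow> s \<le> t" for s
    unfolding group_sum_chromatic_number_def by (rule Least_equality) (use that in auto)
  show ?thesis
  proof (split if_split, intro conjI impI)
    assume "\<not> (\<exists>C\<^sub>1\<in>graph_components G. ugly C\<^sub>1 \<and> chromatic_number C\<^sub>1 = ?s) \<and>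
        ((\<exists>q\<ge>2. ?s = 2 ^ q) \<longrightarrow>
           \<not> (\<exists>C\<^sub>2\<in>graph_components G. graph_isomorphic C\<^sub>2 (complete_graph (?s - 2))))"
    then have "group_sum_colourable G ?s"
      using group_sum_colourable_chromatic_number[OF assms(1,3) two] by blast
    then show "group_sum_chromatic_number G = ?s"
      using two chromatic_number_le_group_sum[OF assms(1)] by (intro least) auto
  next
    assume "\<not> (\<not> (\<exists>C\<^sub>1\<in>graph_components G. ugly C\<^sub>1 \<and> chromatic_number C\<^sub>1 = ?s) \<and>
        ((\<exists>q\<ge>2. ?s = 2 ^ q) \<longrightarrow>
           \<not> (\<exists>C\<^sub>2\<in>graph_components G. graph_isomorphic C\<^sub>2 (complete_graph (?s - 2)))))"
    then consider (ugly) u where "u \<in> verts G" "ugly (component G u)" "chromatic_number (component G u) = ?s"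
      | (complete) u q where "u \<in> verts G" "q \<ge> 2" "?s = 2 ^ q"
          "graph_isomorphic (component G u) (complete_graph (?s - 2))"
      unfolding graph_components_eq by blast
    \<comment> \<open>Evenness is recorded along with the obstruction because it makes the next
      order \<open>?s + 1\<close> odd.\<close>
    then have "\<not> group_sum_colourable G ?s \<and> even ?s"
    proof cases
      case ugly
      then have "(\<exists>k. ?s = 4 * k + 2) \<or> (\<exists>q\<ge>2. ?s = 2 ^ q)" unfolding ugly_def by metis
      then have "even ?s" by auto
      then show ?thesis using not_group_sum_colourable_ugly[OF assms(1) ugly] by blast
    next
      case complete
      then have "even ?s" by simp
      then show ?thesis using not_group_sum_colourable_complete[OF assms(1) complete] by blast
    qed
    then have no: "\<not> group_sum_colourable G ?s" and ev: "even ?s" by auto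
    show "group_sum_chromatic_number G = ?s + 1"
    proof (rule least)
      show "group_sum_colourable G (?s + 1)"
        using group_sum_colourable_Suc_chromatic_number[OF assms(1,3) two ev] .
      fix t assume t: "0 < t" "group_sum_colourable G t"
      then have "?s \<le> t" "t \<noteq> ?s" using chromatic_number_le_group_sum[OF assms(1)] no by auto
      then show "?s + 1 \<le> t" by simp
    qed simp
  qed
qed

end
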